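(* Let $\mathcal{Z}$ be a mixing shift of finite type with left shift $\sigma$. Let $\Theta$ be a compact metric space, $\{f_\theta:\theta\in\Theta\}$ a regular family of Hölder potentials on $\mathcal{Z}$, and $\mu_\theta$ the Gibbs measure of $f_\theta$. Let $\Pi_0$ be a fully supported Borel probability measure on $\Theta$, and let $\theta^*\in\Theta$. Let $\mathbf{Y}=(Y_k)_{k\in\mathbb{Z}}$ be distributed according to $\mu_{\theta^*}$. For each $n$ define the posterior \[ \Pi_n(A\mid y_0^{n-1})=\frac{\int_A\mu_\theta([y_0^{n-1}])\,d\Pi_0(\theta)}{\int_\Theta\mu_\theta([y_0^{n-1}])\,d\Pi_0(\theta)}, \] where $[y_0^{n-1}]=\{z\in\mathcal{Z}:z_0^{n-1}=y_0^{n-1}\}$. Let $[\theta^*]=\{\theta\in\Theta:\mu_\theta=\mu_{\theta^*}\}$. Then for every open $U\subset\Theta$ containing $[\theta^*]$, with $\mu_{\theta^*}$-probability one, \[ \lim_{n\to\infty}\Pi_n(\Theta\setminus U\mid Y_0^{n-1})=0. \]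
   Context: A mixing shift of finite type $\mathcal{Z}\subset\mathcal{A}^{\mathbb{Z}}$ ($\mathcal{A}$ finite) is the set of sequences avoiding a fixed finite set of forbidden words, such that for any two words $u,v$ occurring in $\mathcal{Z}$ there is $N$ so that for each $m\ge N$ some word $w$ of length $m$ makes $uwv$ occur in $\mathcal{Z}$. The shift is $(\sigma z)_i=z_{i+1}$ and the metric is $d(x,y)=2^{-n(x,y)}$ with $n(x,y)=\inf\{|m|:x_m\ne y_m\}$. $C^r(\mathcal{Z})$ is the space of $r$-Hölder functions with norm $\|f\|_r=\sup|f|+\sup_{x\neq y}|f(x)-f(y)|/d(x,y)^r$. A family $\{f_\theta\}$ is regular if for some $r>0$ all $f_\theta\in C^r(\mathcal{Z})$ and $\theta\mapsto f_\theta$ is continuous in $\|\cdot\|_r$. The Gibbs measure $\mu_\theta$ is the unique $\sigma$-invariant Borel probability measure for which there are constants $K>0$ and $\mathcal{P}(f_\theta)$ (the pressure) with \[ K^{-1}\le\mu_\theta(x[0,m-1])\big/\exp\bigl(-m\mathcal{P}(f_\theta)+\textstyle\sum_{k<m}f_\theta(\sigma^kx)\bigr)\le K \] for all $x\in\mathcal{Z}$ and $m\ge1$, where $x[0,m-1]$ is the cylinder of points agreeing with $x$ on coordinates $0,\dots,m-1$. *)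

theory Defs
  imports "HOL-Probability.Probability"
begin

definition shift :: "(int \<Rightarrow> 'a) \<Rightarrow> (int \<Rightarrow> 'a)" where
  "shift x = (\<lambda>i. x (i + 1))"

definition occurs_at :: "(int \<Rightarrow> 'a) \<Rightarrow> int \<Rightarrow> 'a list \<Rightarrow> bool" where
  "occurs_at x i w \<longleftrightarrow> (\<forall>j<length w. x (i + int j) = w ! j)"

definition avoiding :: "'a list set \<Rightarrow> (int \<Rightarrow> 'a) set" where
  "avoiding F = {x. \<forall>w\<in>F. \<forall>i. \<not> occurs_at x i w}"

definition occurs_in :: "(int \<Rightarrow> 'a) set \<Rightarrow> 'a list \<Rightarrow> bool" where
  "occurs_in Z w \<longleftrightarrow> (\<exists>x\<in>Z. \<exists>i. occurs_at x i w)"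

definition mixing_sft :: "(int \<Rightarrow> 'a::finite) set \<Rightarrow> bool" where
  "mixing_sft Z \<longleftrightarrow>
     (\<exists>F. finite F \<and> Z = avoiding F) \<and>
     (\<forall>u v. occurs_in Z u \<longrightarrow> occurs_in Z v \<longrightarrow>
        (\<exists>N. \<forall>m\<ge>N. \<exists>w. length w = m \<and> occurs_in Z (u @ w @ v)))"

definition seq_dist :: "(int \<Rightarrow> 'a) \<Rightarrow> (int \<Rightarrow> 'a) \<Rightarrow> real" where
  "seq_dist x y = (if x = y then 0
     else (1/2) ^ (LEAST k. \<exists>m. nat \<bar>m\<bar> = k \<and> x m \<noteq> y m))"

definition holder :: "(int \<Rightarrow> 'a) set \<Rightarrow> real \<Rightarrow> ((int \<Rightarrow> 'a) \<Rightarrow> real) \<Rightarrow> bool" where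
  "holder Z r f \<longleftrightarrow> bdd_above ((\<lambda>x. \<bar>f x\<bar>) ` Z) \<and>
     bdd_above ((\<lambda>(x,y). \<bar>f x - f y\<bar> / seq_dist x y powr r) ` {(x,y). x \<in> Z \<and> y \<in> Z \<and> x \<noteq> y})"

definition holder_norm :: "(int \<Rightarrow> 'a) set \<Rightarrow> real \<Rightarrow> ((int \<Rightarrow> 'a) \<Rightarrow> real) \<Rightarrow> real" where
  "holder_norm Z r f = (SUP x\<in>Z. \<bar>f x\<bar>) +
     (SUP (x,y)\<in>{(x,y). x \<in> Z \<and> y \<in> Z \<and> x \<noteq> y}. \<bar>f x - f y\<bar> / seq_dist x y powr r)"

definition regular_family ::
  "(int \<Rightarrow> 'a) set \<Rightarrow> 'b::metric_space set \<Rightarrow> ('b \<Rightarrow> (int \<Rightarrow> 'a) \<Rightarrow> real) \<Rightarrow> bool" where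
  "regular_family Z \<Theta> f \<longleftrightarrow> (\<exists>r>0. (\<forall>\<theta>\<in>\<Theta>. holder Z r (f \<theta>)) \<and>
     (\<forall>\<theta>0\<in>\<Theta>. \<forall>\<epsilon>>0. \<exists>\<delta>>0. \<forall>\<theta>\<in>\<Theta>. dist \<theta> \<theta>0 < \<delta> \<longrightarrow>
        holder_norm Z r (\<lambda>x. f \<theta> x - f \<theta>0 x) < \<epsilon>))"

definition seq_space :: "(int \<Rightarrow> 'a) measure" where
  "seq_space = PiM UNIV (\<lambda>_. count_space UNIV)"

definition cyl :: "(int \<Rightarrow> 'a) set \<Rightarrow> (int \<Rightarrow> 'a) \<Rightarrow> nat \<Rightarrow> (int \<Rightarrow> 'a) set" where
  "cyl Z x m = {z\<in>Z. \<forall>i<m. z (int i) = x (int i)}"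

definition gibbs_measure ::
  "(int \<Rightarrow> 'a) set \<Rightarrow> ((int \<Rightarrow> 'a) \<Rightarrow> real) \<Rightarrow> (int \<Rightarrow> 'a) measure \<Rightarrow> bool" where
  "gibbs_measure Z f \<mu> \<longleftrightarrow>
     sets \<mu> = sets seq_space \<and> prob_space \<mu> \<and> Z \<in> sets \<mu> \<and> emeasure \<mu> Z = 1 \<and>
     (\<forall>A\<in>sets \<mu>. shift -` A \<in> sets \<mu> \<and> emeasure \<mu> (shift -` A) = emeasure \<mu> A) \<and>
     (\<exists>K>0. \<exists>P. \<forall>x\<in>Z. \<forall>m\<ge>1.
        inverse K \<le> measure \<mu> (cyl Z x m) / exp (- real m * P + (\<Sum>k<m. f ((shift ^^ k) x))) \<and>
        measure \<mu> (cyl Z x m) / exp (- real m * P + (\<Sum>k<m. f ((shift ^^ k) x))) \<le> K)"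

definition posterior ::
  "(int \<Rightarrow> 'a) set \<Rightarrow> 'b measure \<Rightarrow> ('b \<Rightarrow> (int \<Rightarrow> 'a) measure) \<Rightarrow> nat \<Rightarrow> (int \<Rightarrow> 'a) \<Rightarrow> 'b set \<Rightarrow> real" where
  "posterior Z \<Pi>0 \<mu> n y A =
     (\<integral>\<theta>. indicator A \<theta> * measure (\<mu> \<theta>) (cyl Z y n) \<partial>\<Pi>0) /
     (\<integral>\<theta>. measure (\<mu> \<theta>) (cyl Z y n) \<partial>\<Pi>0)"

end

theory Submission
  imports Defs
begin

text \<open>Write \<open>p\<close> for \<open>\<mu>\<^sub>\<theta>\<close> at the true parameter \<open>\<theta>s\<close>. Gluing with a uniform gap makes Gibbs measures
  ergodic, so a Gibbs measure \<open>q \<noteq> p\<close> is singular to \<open>p\<close> and the Hellinger affinity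
  \<open>H\<^sub>n = \<Sum>\<^sub>w sqrt (p[w] q[w])\<close> over words of length \<open>n\<close> tends to \<open>0\<close>. The Gibbs property gives
  \<open>H\<^sub>m\<^sub>+\<^sub>n \<le> C H\<^sub>m H\<^sub>n\<close>, so the decay is exponential, and by Borel-Cantelli \<open>q[y\<^sub>0\<dots>y\<^sub>n\<^sub>-\<^sub>1]\<close> is almost surely
  exponentially smaller than \<open>p[y\<^sub>0\<dots>y\<^sub>n\<^sub>-\<^sub>1]\<close>. An upper Gibbs bound that is uniform near each parameter,
  together with continuity of the pressure, spreads this over a neighbourhood, and compactness over
  the complement of \<open>U\<close>. The evidence decays at most subexponentially relative to
  \<open>p[y\<^sub>0\<dots>y\<^sub>n\<^sub>-\<^sub>1]\<close>, since parameters near \<open>\<theta>s\<close> lose an arbitrarily small exponential rate and carry positive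
  prior mass.\<close>

subsection \<open>Submultiplicative weights on words\<close>

text \<open>The obstacle is that a Gibbs constant is supplied separately for each parameter, while
  only the potentials vary continuously. It is overcome on one side only. For upper bounds,
  stationarity lets a measure forget its own constant: over many blocks the constant is a fixed
  factor against an exponential, and what remains depends on distortion, sup norm, pressure and
  gluing gap. Lower bounds are used only at the centre of a ball, or for one parameter at a time,
  where a private constant is lost to any exponential rate. An exceptional null set arises only at
  the centres of finitely many balls, since the comparison inside a ball holds at every point of
  \<open>Z\<close>; this is how uncountably many parameters are handled. Exponential rates, not mere
  singularity, are essential: moving the potential by \<eta> can change cylinder masses by a factor
  of order exp(2 n \<eta>), which only a strictly exponential gap survives.\<close>

definition words :: "nat \<Rightarrow> 'a list set" where
  "words n = {w. length w = n}"

lemma words_iff [simp]: "w \<in> words n \<longleftrightarrow> length w = n"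
  by (simp add: words_def)

lemma finite_words [simp]: "finite (words n :: 'a::finite list set)"
  using finite_lists_length_eq[of "UNIV :: 'a set" n] by (simp add: words_def)

lemma sum_words_append:
  fixes h :: "'a::finite list \<Rightarrow> 'b::comm_monoid_add"
  shows "(\<Sum>w\<in>words (m + n). h w) = (\<Sum>u\<in>words m. \<Sum>v\<in>words n. h (u @ v))"
proof -
  have "bij_betw (\<lambda>(u, v). u @ v) (words m \<times> words n) (words (m + n) :: 'a list set)"
    by (rule bij_betw_byWitness[where f' = "\<lambda>w. (take m w, drop m w)"]) auto
  from sum.reindex_bij_betw[OF this, of h] show ?thesis
    by (simp add: sum.cartesian_product split_def)
qed

text \<open>Only aligned, hence disjoint, blocks are inspected, so an occurrence cuts the word into
  a left part, \<open>w\<close> and a right part, to which submultiplicativity applies.\<close>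

definition occ :: "'a list \<Rightarrow> 'a list \<Rightarrow> nat \<Rightarrow> real" where
  "occ w u i = of_bool (take (length w) (drop (i * length w) u) = w)"

lemma occ_append:
  assumes "length u = i * length w" "length v = length w"
  shows "occ w (u @ v @ x) i = of_bool (v = w)"
  using assms by (simp add: occ_def)

lemma occ_append_earlier:
  assumes "length u = i * length w" "j < i"
  shows "occ w (u @ v) j = occ w u j"
proof -
  have "Suc j * length w \<le> i * length w"
    using assms by (intro mult_le_mono1) simp
  then show ?thesis
    using assms by (simp add: occ_def)
qed

lemma sum_words_occ:
  fixes h :: "'a::finite list \<Rightarrow> real"
  assumes "i < T"
  shows "(\<Sum>u\<in>words (T * length w). h u * occ w u i) =
    (\<Sum>u\<in>words (i * length w). \<Sum>v\<in>words ((T - Suc i) * length w). h (u @ w @ v))"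
proof -
  let ?l = "length w"
  have T: "T * ?l = i * ?l + (?l + (T - Suc i) * ?l)"
  proof -
    have "T = i + (1 + (T - Suc i))" using assms by simp
    then have "T * ?l = (i + (1 + (T - Suc i))) * ?l" by simp
    then show ?thesis by (simp only: distrib_right mult_1)
  qed
  have "(\<Sum>u\<in>words (T * ?l). h u * occ w u i) =
    (\<Sum>u\<in>words (i * ?l). \<Sum>x\<in>words ?l. \<Sum>v\<in>words ((T - Suc i) * ?l).
        h (u @ x @ v) * occ w (u @ x @ v) i)"
    by (simp add: T sum_words_append)
  also have "\<dots> = (\<Sum>u\<in>words (i * ?l). \<Sum>x\<in>words ?l.
        if x = w then (\<Sum>v\<in>words ((T - Suc i) * ?l). h (u @ x @ v)) else 0)"
    by (intro sum.cong refl) (auto simp: occ_append)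
  also have "\<dots> = (\<Sum>u\<in>words (i * ?l). \<Sum>v\<in>words ((T - Suc i) * ?l). h (u @ w @ v))"
    by (simp add: sum.delta)
  finally show ?thesis .
qed

lemma prod_one_plus_telescope:
  fixes g :: "nat \<Rightarrow> real"
  shows "(\<Prod>i<T. 1 + g i) = 1 + (\<Sum>i<T. (\<Prod>j<i. 1 + g j) * g i)"
  by (induction T) (auto simp: algebra_simps)

text \<open>Expanding the product at its last selected factor leaves only gaps whose total weight is
  at most \<open>C\<close>; this is what keeps the constant \<open>B\<close> from accumulating with the number of blocks.\<close>

lemma sum_weight_prod_occ_le:
  fixes G :: "'a::finite list \<Rightarrow> real"
  assumes G0: "\<And>u. G u \<ge> 0" and sub: "\<And>u v. G (u @ v) \<le> B * G u * G v"
    and C: "\<And>n. sum G (words n) \<le> C" and "B \<ge> 0" "a \<ge> 0"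
  shows "(\<Sum>u\<in>words (T * length w). G u * (\<Prod>i<T. 1 + a * occ w u i))
    \<le> C * (1 + a * B\<^sup>2 * C * G w) ^ T"
proof (induction T rule: less_induct)
  case (less T)
  let ?l = "length w"
  define \<kappa> where "\<kappa> = a * B\<^sup>2 * C * G w"
  define A where "A i = (\<Sum>u\<in>words (i * ?l). G u * (\<Prod>j<i. 1 + a * occ w u j))" for i
  have C0: "C \<ge> 0"
    using order_trans[OF sum_nonneg[of "words 0" G] C[of 0]] G0 by blast
  have \<kappa>0: "\<kappa> \<ge> 0"
    unfolding \<kappa>_def using C0 assms by simp
  have occ0: "occ w u i \<ge> 0" for u i
    by (simp add: occ_def)
  have A0: "A i \<ge> 0" for i
    unfolding A_def using G0 occ0 \<open>a \<ge> 0\<close>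
    by (intro sum_nonneg mult_nonneg_nonneg prod_nonneg) auto
  \<comment> \<open>One factor \<open>B\<close> for each of the two cuts around \<open>w\<close>;
    this is the \<open>B\<^sup>2\<close> of the final bound.\<close>
  have sub3: "G (u @ w @ v) \<le> (B\<^sup>2 * G w) * G u * G v" for u v
  proof -
    have "G (u @ w @ v) \<le> B * G u * G (w @ v)" by (rule sub)
    also have "\<dots> \<le> B * G u * (B * G w * G v)"
      using G0 \<open>B \<ge> 0\<close> sub by (intro mult_left_mono) auto
    finally show ?thesis by (simp add: power2_eq_square ac_simps)
  qed
  have step: "(\<Sum>u\<in>words (T * ?l). G u * ((\<Prod>j<i. 1 + a * occ w u j) * (a * occ w u i))) \<le> \<kappa> * A i"
    if "i < T" for i
  proof -
    have "(\<Sum>u\<in>words (T * ?l). G u * ((\<Prod>j<i. 1 + a * occ w u j) * (a * occ w u i)))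
      = (\<Sum>u\<in>words (T * ?l). a * G u * (\<Prod>j<i. 1 + a * occ w u j) * occ w u i)"
      by (simp add: ac_simps)
    also have "\<dots> = (\<Sum>u\<in>words (i * ?l). \<Sum>v\<in>words ((T - Suc i) * ?l).
        a * G (u @ w @ v) * (\<Prod>j<i. 1 + a * occ w (u @ w @ v) j))"
      using that by (rule sum_words_occ)
    also have "\<dots> = (\<Sum>u\<in>words (i * ?l). \<Sum>v\<in>words ((T - Suc i) * ?l).
        a * G (u @ w @ v) * (\<Prod>j<i. 1 + a * occ w u j))"
      by (intro sum.cong refl arg_cong2[where f = "(*)"] prod.cong) (auto simp: occ_append_earlier[where i = i])
    also have "\<dots> \<le> (\<Sum>u\<in>words (i * ?l). \<Sum>v\<in>words ((T - Suc i) * ?l).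
        a * ((B\<^sup>2 * G w) * G u * G v) * (\<Prod>j<i. 1 + a * occ w u j))"
      using sub3 G0 occ0 \<open>a \<ge> 0\<close>
      by (intro sum_mono mult_right_mono mult_left_mono prod_nonneg) auto
    also have "\<dots> = (a * B\<^sup>2 * G w) * A i * sum G (words ((T - Suc i) * ?l))"
      by (simp add: A_def sum_distrib_left sum_distrib_right ac_simps)
    also have "\<dots> \<le> (a * B\<^sup>2 * G w) * A i * C"
      using A0 G0 C \<open>a \<ge> 0\<close> by (intro mult_left_mono) auto
    finally show ?thesis by (simp add: \<kappa>_def ac_simps)
  qed
  have "A T = (\<Sum>u\<in>words (T * ?l). G u +
      (\<Sum>i<T. G u * ((\<Prod>j<i. 1 + a * occ w u j) * (a * occ w u i))))"
    unfolding A_def by (subst prod_one_plus_telescope) (simp add: algebra_simps sum_distrib_left)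
  also have "\<dots> = sum G (words (T * ?l)) +
      (\<Sum>i<T. \<Sum>u\<in>words (T * ?l). G u * ((\<Prod>j<i. 1 + a * occ w u j) * (a * occ w u i)))"
    unfolding sum.distrib by (intro arg_cong2[where f = "(+)"] refl sum.swap)
  also have "\<dots> \<le> C + (\<Sum>i<T. \<kappa> * (C * (1 + \<kappa>) ^ i))"
  proof (intro add_mono C sum_mono)
    fix i assume "i \<in> {..<T}"
    then have i: "i < T" by simp
    have "\<kappa> * A i \<le> \<kappa> * (C * (1 + \<kappa>) ^ i)"
      using less.IH[OF i] \<kappa>0 unfolding A_def \<kappa>_def by (intro mult_left_mono) auto
    with step[OF i]
    show "(\<Sum>u\<in>words (T * ?l). G u * ((\<Prod>j<i. 1 + a * occ w u j) * (a * occ w u i)))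
        \<le> \<kappa> * (C * (1 + \<kappa>) ^ i)"
      by linarith
  qed
  also have "\<dots> = C * (1 + \<kappa>) ^ T"
    using prod_one_plus_telescope[of "\<lambda>_. \<kappa>" T]
    by (simp add: sum_distrib_left sum_distrib_right algebra_simps)
  finally show ?case by (simp add: A_def \<kappa>_def)
qed

text \<open>The bound does not involve \<open>K\<close>: compare exponential moments of the number of occurrences
  of \<open>w\<close> at multiples of its length among \<open>T\<close> blocks and let \<open>T\<close> tend to infinity.\<close>

lemma stationary_le_weight:
  fixes m G :: "'a::finite list \<Rightarrow> real"
  assumes G0: "\<And>u. G u \<ge> 0" and sub: "\<And>u v. G (u @ v) \<le> B * G u * G v"
    and C: "\<And>n. sum G (words n) \<le> C" and "B \<ge> 0"
    and m0: "\<And>u. m u \<ge> 0" and m1: "m [] = 1"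
    and right: "\<And>n u. (\<Sum>v\<in>words n. m (u @ v)) = m u"
    and left: "\<And>n v. (\<Sum>u\<in>words n. m (u @ v)) = m v"
    and K: "\<And>u. m u \<le> K * G u"
  shows "m w \<le> (exp 1 - 1) * B\<^sup>2 * C * G w"
proof -
  let ?l = "length w"
  define \<kappa> where "\<kappa> = (exp 1 - 1) * B\<^sup>2 * C * G w"
  have C0: "C \<ge> 0"
    using order_trans[OF sum_nonneg[of "words 0" G] C[of 0]] G0 by blast
  have "\<kappa> \<ge> 0"
    unfolding \<kappa>_def using C0 G0 by simp
  have KG: "1 \<le> K * G []" using K[of "[]"] m1 by simp
  then have K0: "K > 0"
    using G0[of "[]"] by (metis less_numeral_extra(1) linorder_not_le mult_nonpos_nonneg order_trans)
  have G_nil: "G [] > 0"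
    using G0[of "[]"] KG by (cases "G [] = 0") auto
  have C_pos: "C > 0"
    using C[of 0] G_nil by (simp add: words_def)
  have total: "sum m (words n) = 1" for n
    using right[where n = n and u = "[]"] m1 by simp
  have main: "real T * (m w - \<kappa>) \<le> ln (K * C)" for T
  proof -
    define X where "X u = (\<Sum>i<T. occ w u i)" for u
    have mean: "(\<Sum>u\<in>words (T * ?l). m u * X u) = real T * m w"
    proof -
      have "(\<Sum>u\<in>words (T * ?l). m u * X u) = (\<Sum>i<T. \<Sum>u\<in>words (T * ?l). m u * occ w u i)"
        unfolding X_def sum_distrib_left by (rule sum.swap)
      also have "\<dots> = (\<Sum>i<T. m w)"
      proof (rule sum.cong[OF refl])
        fix i assume "i \<in> {..<T}"
        then have "(\<Sum>u\<in>words (T * ?l). m u * occ w u i) = (\<Sum>u\<in>words (i * ?l). m (u @ w))"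
          using right[where n = "(T - Suc i) * ?l" and u = "_ @ w"] by (simp add: sum_words_occ)
        then show "(\<Sum>u\<in>words (T * ?l). m u * occ w u i) = m w"
          using left by simp
      qed
      finally show ?thesis by simp
    qed
    \<comment> \<open>\<open>occ\<close> takes only the values 0 and 1, and
      \<open>1 + (exp 1 - 1) * occ\<close> is then 1 or \<open>exp 1\<close>; this is why
      \<open>exp 1 - 1\<close> is the right coefficient for an exponential moment.\<close>
    have expX: "(\<Prod>i<T. 1 + (exp 1 - 1) * occ w u i) = exp (X u)" for u
      unfolding X_def exp_sum[OF finite_lessThan] by (intro prod.cong) (auto simp: occ_def)
    define c where "c = real T * m w"
    \<comment> \<open>Jensen's inequality for the exponential, through its tangent at the mean
      \<open>c\<close>: averaging the tangent line against \<open>m\<close> returns exactly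
      \<open>exp c\<close>.\<close>
    have "exp c = (\<Sum>u\<in>words (T * ?l). m u * (exp c * (1 + X u - c)))"
    proof -
      have "(\<Sum>u\<in>words (T * ?l). m u * (exp c * (1 + X u - c)))
        = (\<Sum>u\<in>words (T * ?l). (exp c * (1 - c)) * m u + exp c * (m u * X u))"
        by (intro sum.cong) (auto simp: algebra_simps)
      also have "\<dots> = exp c * (1 - c) * sum m (words (T * ?l)) +
          exp c * (\<Sum>u\<in>words (T * ?l). m u * X u)"
        by (simp add: sum.distrib sum_distrib_left)
      also have "\<dots> = exp c"
        by (simp add: total mean flip: c_def) (simp add: algebra_simps)
      finally show ?thesis by simp
    qed
    also have "\<dots> \<le> (\<Sum>u\<in>words (T * ?l). m u * exp (X u))"
    proof (intro sum_mono mult_left_mono m0)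
      fix u
      have "1 + (X u - c) \<le> exp (X u - c)" by (rule exp_ge_add_one_self)
      then have "exp c * (1 + X u - c) \<le> exp c * exp (X u - c)"
        by (intro mult_left_mono) (auto simp: algebra_simps)
      then show "exp c * (1 + X u - c) \<le> exp (X u)"
        by (simp flip: exp_add)
    qed
    also have "\<dots> \<le> (\<Sum>u\<in>words (T * ?l). K * G u * exp (X u))"
      by (intro sum_mono mult_right_mono K) auto
    also have "\<dots> = K * (\<Sum>u\<in>words (T * ?l). G u * (\<Prod>i<T. 1 + (exp 1 - 1) * occ w u i))"
      by (simp add: expX sum_distrib_left ac_simps)
    also have "\<dots> \<le> K * (C * (1 + \<kappa>) ^ T)"
      unfolding \<kappa>_def using K0 assms by (intro mult_left_mono sum_weight_prod_occ_le) auto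
    also have "\<dots> \<le> K * (C * exp \<kappa> ^ T)"
      using K0 C0 \<open>\<kappa> \<ge> 0\<close>
      by (intro mult_left_mono power_mono exp_ge_add_one_self) auto
    also have "\<dots> = exp (ln (K * C) + real T * \<kappa>)"
      using K0 C_pos by (simp add: exp_add exp_of_nat_mult)
    finally have "c \<le> ln (K * C) + real T * \<kappa>" by simp
    then show ?thesis by (simp add: c_def algebra_simps)
  qed
  have "m w - \<kappa> \<le> 0"
  proof (rule ccontr)
    assume "\<not> ?thesis"
    then obtain T :: nat where "ln (K * C) < real T * (m w - \<kappa>)"
      using reals_Archimedean3[of "m w - \<kappa>"] by (auto simp: not_le)
    with main[of T] show False by simp
  qed
  then show ?thesis by (simp add: \<kappa>_def)
qed

text \<open>If \<open>b * sum G (words n)\<close> exceeded 1, chaining words of length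
  \<open>n\<close> across gaps of length \<open>N\<close> would make the sums grow geometrically,
  against the crude bound \<open>K\<close>. So \<open>K\<close> only certifies finiteness and is
  absent from the conclusion.\<close>

lemma sum_words_le_of_supermultiplicative:
  fixes G :: "'a::finite list \<Rightarrow> real"
  assumes G0: "\<And>u. G u \<ge> 0" and "b > 0"
    and super: "\<And>u v. b * G u * G v \<le> (\<Sum>c\<in>words N. G (u @ c @ v))"
    and bdd: "\<And>n. sum G (words n) \<le> K"
  shows "sum G (words n) \<le> 1 / b"
proof (rule ccontr)
  define S where "S n = sum G (words n)" for n
  assume "\<not> ?thesis"
  then have gt: "1 < b * S n"
    using \<open>b > 0\<close> by (simp add: S_def field_simps)
  have S0: "S k \<ge> 0" for k unfolding S_def using G0 by (simp add: sum_nonneg)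
  have super_S: "b * S i * S j \<le> S (i + (N + j))" for i j
  proof -
    have "b * S i * S j = (\<Sum>u\<in>words i. \<Sum>v\<in>words j. b * G u * G v)"
      unfolding S_def by (simp add: sum_distrib_left sum_distrib_right mult.assoc, subst sum.swap, rule refl)
    also have "\<dots> \<le> (\<Sum>u\<in>words i. \<Sum>v\<in>words j. \<Sum>c\<in>words N. G (u @ c @ v))"
      by (intro sum_mono super)
    also have "\<dots> = (\<Sum>u\<in>words i. \<Sum>c\<in>words N. \<Sum>v\<in>words j. G (u @ c @ v))"
      by (intro sum.cong refl sum.swap)
    finally show ?thesis by (simp add: S_def sum_words_append)
  qed
  have "\<exists>j. (b * S n) ^ k * S n \<le> S j" for k
  proof (induction k)
    case (Suc k)
    then obtain j where j: "(b * S n) ^ k * S n \<le> S j" by blast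
    have "(b * S n) ^ Suc k * S n = (b * S n) * ((b * S n) ^ k * S n)"
      by simp
    also have "\<dots> \<le> (b * S n) * S j"
      using j \<open>b > 0\<close> S0 by (intro mult_left_mono) auto
    also have "\<dots> \<le> S (n + (N + j))" by (rule super_S)
    finally show ?case by blast
  qed auto
  then have bound: "(b * S n) ^ k * S n \<le> K" for k
    using bdd unfolding S_def by (meson order_trans)
  have "S n > 0" using gt S0[of n] by (cases "S n = 0") auto
  obtain k where "K / S n < (b * S n) ^ k"
    using real_arch_pow[OF gt] by blast
  with bound[of k] \<open>S n > 0\<close> show False
    by (simp add: field_simps)
qed

subsection \<open>Gluing in mixing shifts of finite type\<close>

lemma funpow_shift: "(shift ^^ k) z = (\<lambda>i. z (i + int k))"
  by (induction k) (auto simp: shift_def algebra_simps)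

definition window :: "(int \<Rightarrow> 'a) \<Rightarrow> nat \<Rightarrow> 'a list" where
  "window z n = map (\<lambda>i. z (int i)) [0..<n]"

lemma length_window [simp]: "length (window z n) = n"
  by (simp add: window_def)

lemma nth_window [simp]: "i < n \<Longrightarrow> window z n ! i = z (int i)"
  by (simp add: window_def)

lemma window_0 [simp]: "window z 0 = []"
  by (simp add: window_def)

lemma window_add: "window z (m + n) = window z m @ window ((shift ^^ m) z) n"
  by (rule nth_equalityI) (auto simp: nth_append funpow_shift of_nat_diff)

lemma window_eq_iff: "window x n = window y n \<longleftrightarrow> (\<forall>i<n. x (int i) = y (int i))"
  by (simp add: list_eq_iff_nth_eq)

lemma window_append_iff:
  "window z (length u + length v) = u @ v \<longleftrightarrow>
     window z (length u) = u \<and> window ((shift ^^ length u) z) (length v) = v"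
  by (simp add: window_add)

lemma cyl_eq_window: "cyl Z x n = {z \<in> Z. window z n = window x n}"
  by (auto simp: cyl_def window_eq_iff)

lemma occurs_at_cong:
  assumes "occurs_at x i w" "\<And>j. j < length w \<Longrightarrow> x (i + int j) = y (i' + int j)"
  shows "occurs_at y i' w"
  using assms by (auto simp: occurs_at_def)

lemma avoiding_translate:
  assumes "z \<in> avoiding F"
  shows "(\<lambda>i. z (i + k)) \<in> avoiding F"
proof -
  have "\<not> occurs_at (\<lambda>i. z (i + k)) i w" if "w \<in> F" for i w
  proof
    assume "occurs_at (\<lambda>i. z (i + k)) i w"
    then have "occurs_at z (i + k) w"
      by (rule occurs_at_cong) (simp add: algebra_simps)
    with assms that show False by (auto simp: avoiding_def)
  qed
  then show ?thesis by (simp add: avoiding_def)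
qed

lemma occurs_in_window:
  assumes "x \<in> Z"
  shows "occurs_in Z (map (\<lambda>j. x (i + int j)) [0..<n])"
  unfolding occurs_in_def using assms by (intro bexI[of _ x] exI[of _ i]) (auto simp: occurs_at_def)

text \<open>Mixing allots a gap to each pair of words. Forbidden words have length at most
  \<open>L\<close>, so gluing only has to look at the \<open>L\<close> symbols on either side of the
  gap; these pairs are finitely many and can share one gap.\<close>

lemma mixing_sft_glue:
  fixes Z :: "(int \<Rightarrow> 'a::finite) set"
  assumes "mixing_sft Z"
  shows "\<exists>N. \<forall>x\<in>Z. \<forall>y\<in>Z. \<exists>t\<in>Z. (\<forall>i<0. t i = x i) \<and> (\<forall>i\<ge>int N. t i = y i)"
proof -
  from assms obtain F where F: "finite F" "Z = avoiding F"
    and mix: "\<And>u v. occurs_in Z u \<Longrightarrow> occurs_in Z v \<Longrightarrow>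
      \<exists>N. \<forall>m\<ge>N. \<exists>w. length w = m \<and> occurs_in Z (u @ w @ v)"
    unfolding mixing_sft_def by blast
  obtain L where L: "\<And>w. w \<in> F \<Longrightarrow> length w \<le> L"
    using finite_nat_set_iff_bounded_le[of "length ` F"] F(1) by auto
  have "\<forall>p. \<exists>N. occurs_in Z (fst p) \<longrightarrow> occurs_in Z (snd p) \<longrightarrow>
      (\<forall>m\<ge>N. \<exists>w. length w = m \<and> occurs_in Z (fst p @ w @ snd p))"
    using mix by blast
  then obtain h where h: "\<And>p. occurs_in Z (fst p) \<Longrightarrow> occurs_in Z (snd p) \<Longrightarrow>
      (\<forall>m\<ge>h p. \<exists>w. length w = m \<and> occurs_in Z (fst p @ w @ snd p))"
    by metis
  have fin: "finite (h ` (words L \<times> words L))"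
    by (intro finite_imageI finite_cartesian_product finite_words)
  define N where "N = Max (h ` (words L \<times> words L))"
  have N: "h (u, v) \<le> N" if "length u = L" "length v = L" for u v
    unfolding N_def using that by (intro Max_ge fin imageI) auto
  have "\<exists>t\<in>Z. (\<forall>i<0. t i = x i) \<and> (\<forall>i\<ge>int N. t i = y i)" if "x \<in> Z" "y \<in> Z" for x y
  proof -
    define u where "u = map (\<lambda>j. x (- int L + int j)) [0..<L]"
    define v where "v = map (\<lambda>j. y (int N + int j)) [0..<L]"
    have "occurs_in Z u" "occurs_in Z v"
      unfolding u_def v_def by (intro occurs_in_window that)+
    with h[of "(u, v)"] N[of u v] obtain c where c: "length c = N" "occurs_in Z (u @ c @ v)"
      by (auto simp: u_def v_def)
    then obtain z i where z: "z \<in> Z" and occ: "occurs_at z i (u @ c @ v)"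
      unfolding occurs_in_def by blast
    \<comment> \<open>Splice: \<open>x\<close> on the left, the filler found in \<open>z\<close>
      over the gap, \<open>y\<close> on the right. On \<open>[-L, N + L)\<close> the result
      coincides with a translate of \<open>z\<close>.\<close>
    define t where "t j = (if j < 0 then x j else if j < int N then z (i + int L + j) else y j)" for j
    have [simp]: "length u = L" "length v = L" by (simp_all add: u_def v_def)
    have occ': "z (i + int j) = (u @ c @ v) ! j" if "j < L + (N + L)" for j
      using occ that c unfolding occurs_at_def by simp
    have t_left: "t j = z (i + int L + j)" if "- int L \<le> j" "j < 0" for j
    proof -
      have "z (i + int (nat (j + int L))) = x j"
        using that by (subst occ') (auto simp: nth_append u_def nat_less_iff)
      then show ?thesis using that by (simp add: t_def algebra_simps)
    qed
    have t_right: "t j = z (i + int L + j)" if "int N \<le> j" "j < int N + int L" for j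
    proof -
      have "z (i + int (nat (j + int L))) = y j"
        using that c by (subst occ') (auto simp: nth_append v_def nat_less_iff nat_diff_distrib' of_nat_diff)
      then show ?thesis using that by (simp add: t_def algebra_simps)
    qed
    have t_mid: "t j = z (i + int L + j)" if "- int L \<le> j" "j < int N + int L" for j
      using t_left[of j] t_right[of j] that by (cases "j < 0"; cases "j < int N") (auto simp: t_def)
    have "\<not> occurs_at t s w" if "w \<in> F" for s w
    proof
      assume s: "occurs_at t s w"
      have len: "length w \<le> L" using L that by blast
      \<comment> \<open>A word of length at most \<open>L\<close> starting before \<open>-L\<close>
        ends before 0 and lies in \<open>x\<close>; starting between \<open>-L\<close> and
        \<open>N\<close> it stays in the stretch copied from \<open>z\<close>; starting later it
        lies in \<open>y\<close>.\<close>
      consider "s < - int L" | "- int L \<le> s" "s \<le> int N" | "int N < s" by linarith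
      then have "\<exists>z\<in>Z. \<exists>s. occurs_at z s w"
      proof cases
        case 1
        have "occurs_at x s w"
          using s by (rule occurs_at_cong) (use 1 len in \<open>auto simp: t_def\<close>)
        then show ?thesis using \<open>x \<in> Z\<close> by blast
      next
        case 2
        have "occurs_at z (i + int L + s) w"
          using s by (rule occurs_at_cong) (use 2 len t_mid in \<open>auto simp: algebra_simps\<close>)
        then show ?thesis using z by blast
      next
        case 3
        have "occurs_at y s w"
          using s by (rule occurs_at_cong) (use 3 len in \<open>auto simp: t_def\<close>)
        then show ?thesis using \<open>y \<in> Z\<close> by blast
      qed
      with that F(2) show False by (auto simp: avoiding_def)
    qed
    then have "t \<in> Z" by (simp add: F(2) avoiding_def)
    then show ?thesis by (intro bexI[of _ t]) (auto simp: t_def)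
  qed
  then show ?thesis by blast
qed

text \<open>What is kept of finite type and mixing: invariance under all translations, and splicing
  across a gap of one fixed length.\<close>

locale glued_shift =
  fixes Z :: "(int \<Rightarrow> 'a::finite) set" and N :: nat
  assumes translate: "\<And>z k. z \<in> Z \<Longrightarrow> (\<lambda>i. z (i + k)) \<in> Z"
    and glue: "\<And>x y. x \<in> Z \<Longrightarrow> y \<in> Z \<Longrightarrow> \<exists>t\<in>Z. (\<forall>i<0. t i = x i) \<and> (\<forall>i\<ge>int N. t i = y i)"

lemma mixing_sft_glued_shift:
  assumes "mixing_sft Z"
  obtains N where "glued_shift Z N"
proof -
  from assms obtain F where "Z = avoiding F" by (auto simp: mixing_sft_def)
  with mixing_sft_glue[OF assms] avoiding_translate[of _ F] that show ?thesis
    unfolding glued_shift_def by blast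
qed

context glued_shift
begin

lemma shift_funpow_mem [simp]: "z \<in> Z \<Longrightarrow> (shift ^^ k) z \<in> Z"
  using translate by (simp add: funpow_shift)

lemma shift_mem_iff: "shift z \<in> Z \<longleftrightarrow> z \<in> Z"
  using translate[of z 1] translate[of "shift z" "-1"] by (auto simp: shift_def)

lemma glue_window:
  assumes "x \<in> Z" "y \<in> Z"
  obtains t where "t \<in> Z" "window t n = window x n"
    "\<And>m. window ((shift ^^ (n + N)) t) m = window y m"
proof -
  from glue[OF translate[OF assms(1), of "int n"] translate[OF assms(2), of "- int N"]]
  obtain t where t: "t \<in> Z" "\<And>i. i < 0 \<Longrightarrow> t i = x (i + int n)" "\<And>i. i \<ge> int N \<Longrightarrow> t i = y (i - int N)"
    by auto
  show thesis
  proof (rule that)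
    show "(\<lambda>i. t (i + (- int n))) \<in> Z" by (rule translate) (rule t)
  qed (auto simp: window_eq_iff funpow_shift t)
qed

end

subsection \<open>Distortion of Birkhoff sums\<close>

definition birkhoff :: "((int \<Rightarrow> 'a) \<Rightarrow> real) \<Rightarrow> (int \<Rightarrow> 'a) \<Rightarrow> nat \<Rightarrow> real" where
  "birkhoff f x n = (\<Sum>k<n. f ((shift ^^ k) x))"

lemma birkhoff_0 [simp]: "birkhoff f x 0 = 0"
  by (simp add: birkhoff_def)

lemma birkhoff_add: "birkhoff f x (m + n) = birkhoff f x m + birkhoff f ((shift ^^ m) x) n"
proof -
  have "birkhoff f x (m + n) = (\<Sum>k<m. f ((shift ^^ k) x)) + (\<Sum>k=m..<m + n. f ((shift ^^ k) x))"
    unfolding birkhoff_def by (simp add: lessThan_atLeast0 sum.atLeastLessThan_concat)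
  also have "(\<Sum>k=m..<m + n. f ((shift ^^ k) x)) = (\<Sum>k<n. f ((shift ^^ (k + m)) x))"
    using sum.shift_bounds_nat_ivl[of "\<lambda>k. f ((shift ^^ k) x)" 0 m n]
    by (simp add: lessThan_atLeast0 add.commute)
  finally show ?thesis by (simp add: birkhoff_def funpow_add)
qed

lemma seq_dist_le:
  assumes "\<And>i. nat \<bar>i\<bar> < k \<Longrightarrow> x i = y i"
  shows "seq_dist x y \<le> (1/2) ^ k"
proof (cases "x = y")
  case False
  then obtain i where "x i \<noteq> y i" by auto
  then have ex: "\<exists>n m. nat \<bar>m\<bar> = n \<and> x m \<noteq> y m" by blast
  have "k \<le> (LEAST n. \<exists>m. nat \<bar>m\<bar> = n \<and> x m \<noteq> y m)"
    using LeastI_ex[OF ex] assms by (metis not_le)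
  then have "(1/2 :: real) ^ (LEAST n. \<exists>m. nat \<bar>m\<bar> = n \<and> x m \<noteq> y m) \<le> (1/2) ^ k"
    by (intro power_decreasing) auto
  with False show ?thesis by (simp add: seq_dist_def)
qed (simp add: seq_dist_def)

lemma seq_dist_nonneg: "seq_dist x y \<ge> 0"
  by (simp add: seq_dist_def)

text \<open>Twice the geometric series of ratio \<open>(1/2) powr r\<close>, one copy for each end
  of the word on which two points agree.\<close>

definition distortion_const :: "real \<Rightarrow> real \<Rightarrow> real" where
  "distortion_const M r = 2 * M / (1 - (1/2) powr r)"

text \<open>After \<open>k\<close> shifts the two points agree on coordinates \<open>-k\<close> to
  \<open>n - 1 - k\<close>, so the \<open>k\<close>-th difference is exponentially small in the
  distance of \<open>k\<close> from the ends of the word, and the sum is bounded independently of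
  \<open>n\<close>.\<close>

lemma birkhoff_distortion:
  assumes Z: "\<And>z. z \<in> Z \<Longrightarrow> shift z \<in> Z" and "r > 0" "M \<ge> 0"
    and hol: "\<And>x y. x \<in> Z \<Longrightarrow> y \<in> Z \<Longrightarrow> \<bar>f x - f y\<bar> \<le> M * seq_dist x y powr r"
    and xy: "x \<in> Z" "y \<in> Z" "window x n = window y n"
  shows "\<bar>birkhoff f x n - birkhoff f y n\<bar> \<le> distortion_const M r"
proof -
  define q :: real where "q = (1/2) powr r"
  have q: "0 < q" "q < 1"
    unfolding q_def using \<open>r > 0\<close> powr_less_mono'[of "1/2" 0 r] by auto
  have Zk: "(shift ^^ k) z \<in> Z" if "z \<in> Z" for z k
    using that Z by (induction k) auto
  have term_le: "\<bar>f ((shift ^^ k) x) - f ((shift ^^ k) y)\<bar> \<le> M * (q ^ k + q ^ (n - Suc k))"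
    if "k < n" for k
  proof -
    \<comment> \<open>Coordinates of absolute value below \<open>j\<close> lie in the common range
      as soon as \<open>j \<le> k + 1\<close> and \<open>j \<le> n - k\<close>.\<close>
    define j where "j = min (Suc k) (n - k)"
    have "seq_dist ((shift ^^ k) x) ((shift ^^ k) y) \<le> (1/2) ^ j"
    proof (rule seq_dist_le)
      fix i assume i: "nat \<bar>i\<bar> < j"
      have "nat (i + int k) < n" using i that unfolding j_def by linarith
      then have "x (int (nat (i + int k))) = y (int (nat (i + int k)))"
        using xy(3) unfolding window_eq_iff by blast
      moreover have "i + int k \<ge> 0" using i that unfolding j_def by linarith
      ultimately show "(shift ^^ k) x i = (shift ^^ k) y i" by (simp add: funpow_shift)
    qed
    then have "seq_dist ((shift ^^ k) x) ((shift ^^ k) y) powr r \<le> ((1/2) ^ j) powr r"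
      using \<open>r > 0\<close> seq_dist_nonneg by (intro powr_mono2) auto
    also have "\<dots> = q ^ j"
      unfolding q_def by (simp add: powr_powr mult.commute flip: powr_realpow)
    \<comment> \<open>Both exponents are one less than the agreement allows, so that the two sums
      over \<open>k\<close> become the same geometric sum, read forwards and backwards.\<close>
    also have "\<dots> \<le> q ^ k + q ^ (n - Suc k)"
    proof (cases "Suc k \<le> n - k")
      case True
      then have "q ^ j \<le> q ^ k" unfolding j_def using q by (intro power_decreasing) auto
      then show ?thesis using q by (simp add: add_increasing2)
    next
      case False
      then have "q ^ j \<le> q ^ (n - Suc k)" unfolding j_def using q by (intro power_decreasing) auto
      then show ?thesis using q by (simp add: add_increasing)
    qed
    finally have "M * seq_dist ((shift ^^ k) x) ((shift ^^ k) y) powr r \<le> M * (q ^ k + q ^ (n - Suc k))"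
      using \<open>M \<ge> 0\<close> by (rule mult_left_mono)
    with hol[OF Zk[OF xy(1)] Zk[OF xy(2)], of k k] show ?thesis by linarith
  qed
  have geo: "(\<Sum>k<n. q ^ k) \<le> 1 / (1 - q)"
    using q by (subst sum_gp_strict) (auto simp: divide_right_mono)
  have "\<bar>birkhoff f x n - birkhoff f y n\<bar> \<le> (\<Sum>k<n. \<bar>f ((shift ^^ k) x) - f ((shift ^^ k) y)\<bar>)"
    unfolding birkhoff_def by (subst sum_subtractf[symmetric]) (rule sum_abs)
  also have "\<dots> \<le> (\<Sum>k<n. M * (q ^ k + q ^ (n - Suc k)))"
    by (intro sum_mono term_le) auto
  also have "\<dots> = M * ((\<Sum>k<n. q ^ k) + (\<Sum>k<n. q ^ (n - Suc k)))"
    by (simp add: sum_distrib_left sum.distrib distrib_left)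
  also have "(\<Sum>k<n. q ^ (n - Suc k)) = (\<Sum>k<n. q ^ k)"
    by (rule sum.nat_diff_reindex)
  also have "M * ((\<Sum>k<n. q ^ k) + (\<Sum>k<n. q ^ k)) \<le> M * (1 / (1 - q) + 1 / (1 - q))"
    using geo \<open>M \<ge> 0\<close> by (intro mult_left_mono add_mono) auto
  finally show ?thesis by (simp add: distortion_const_def q_def mult.commute)
qed

subsection \<open>Shift-invariant measures\<close>

text \<open>Finite rather than normalised, because the approximation results are also applied to the
  sum of two probability measures.\<close>

locale invariant_measure = finite_measure \<mu> for \<mu> :: "(int \<Rightarrow> 'a::finite) measure" +
  assumes sets_eq: "sets \<mu> = sets seq_space"
    and inv: "\<And>A. A \<in> sets \<mu> \<Longrightarrow> emeasure \<mu> (shift -` A) = emeasure \<mu> A"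
begin

lemma space_eq [simp]: "space \<mu> = UNIV"
  using sets_eq_imp_space_eq[OF sets_eq] by (simp add: seq_space_def space_PiM)

lemma coord_measurable [measurable]: "(\<lambda>z. z i) \<in> measurable \<mu> (count_space UNIV)"
  unfolding measurable_cong_sets[OF sets_eq refl] seq_space_def
  by (rule measurable_component_singleton) simp

lemma coord_sets [measurable]: "{z. z i \<in> A} \<in> sets \<mu>"
proof -
  have "{z \<in> space \<mu>. z i \<in> A} \<in> sets \<mu>" by measurable
  then show ?thesis by simp
qed

lemma window_sets [measurable]: "{z. window z n \<in> S} \<in> sets \<mu>"
proof -
  have "{z. window z n \<in> S} = (\<Union>w\<in>S \<inter> words n. \<Inter>i\<in>{..<n}. {z. z (int i) \<in> {w ! i}})"
  proof (intro set_eqI iffI)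
    fix z assume "z \<in> (\<Union>w\<in>S \<inter> words n. \<Inter>i\<in>{..<n}. {z. z (int i) \<in> {w ! i}})"
    then obtain w where "w \<in> S" "length w = n" "\<forall>i<n. z (int i) = w ! i" by auto
    moreover from this have "window z n = w" by (intro nth_equalityI) auto
    ultimately show "z \<in> {z. window z n \<in> S}" by simp
  next
    fix z assume "z \<in> {z. window z n \<in> S}"
    then show "z \<in> (\<Union>w\<in>S \<inter> words n. \<Inter>i\<in>{..<n}. {z. z (int i) \<in> {w ! i}})"
      by (intro UN_I[of "window z n"]) auto
  qed
  also have "\<dots> \<in> sets \<mu>"
  proof (cases "n = 0")
    case False
    then show ?thesis by (intro sets.finite_UN sets.finite_INT coord_sets) auto
  qed (auto simp: sets.top[of \<mu>, simplified])
  finally show ?thesis .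
qed

lemma window_eq_sets [measurable]: "{z. window z n = w} \<in> sets \<mu>"
  using window_sets[of n "{w}"] by simp

lemma compl_sets: "A \<in> sets \<mu> \<Longrightarrow> - A \<in> sets \<mu>"
  using sets.compl_sets[of A \<mu>] by (simp add: Compl_eq_Diff_UNIV)

lemma vimage_shift_sets: "A \<in> sets \<mu> \<Longrightarrow> shift -` A \<in> sets \<mu>"
proof -
  have "shift \<in> measurable seq_space seq_space"
    unfolding seq_space_def shift_def
    by (rule measurable_PiM_single') (auto intro!: measurable_component_singleton)
  then have "shift \<in> measurable \<mu> \<mu>"
    using measurable_cong_sets[OF sets_eq sets_eq] by simp
  from measurable_sets[OF this] show "A \<in> sets \<mu> \<Longrightarrow> shift -` A \<in> sets \<mu>" by simp
qed

lemma vimage_funpow_shift: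
  assumes "A \<in> sets \<mu>"
  shows "(shift ^^ k) -` A \<in> sets \<mu>" "measure \<mu> ((shift ^^ k) -` A) = measure \<mu> A"
proof -
  have "(shift ^^ k) -` A \<in> sets \<mu> \<and> emeasure \<mu> ((shift ^^ k) -` A) = emeasure \<mu> A"
  proof (induction k)
    case (Suc k)
    have "(shift ^^ Suc k) -` A = shift -` ((shift ^^ k) -` A)"
      by (auto simp: funpow_Suc_right simp del: funpow.simps)
    with Suc show ?case using vimage_shift_sets inv by (simp del: funpow.simps)
  qed (use assms in simp)
  then show "(shift ^^ k) -` A \<in> sets \<mu>" "measure \<mu> ((shift ^^ k) -` A) = measure \<mu> A"
    by (auto simp: measure_def)
qed

section \<open>Masses of words and their stationarity\<close>

definition mass :: "'a list \<Rightarrow> real" where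
  "mass w = measure \<mu> {z. window z (length w) = w}"

lemma mass_nonneg [simp]: "mass w \<ge> 0"
  by (simp add: mass_def)

lemma measure_window: "measure \<mu> {z. window z n \<in> S} = (\<Sum>w\<in>S \<inter> words n. mass w)"
proof -
  have "{z. window z n \<in> S} = (\<Union>w\<in>S \<inter> words n. {z. window z (length w) \<in> {w}})"
    by auto
  also have "measure \<mu> \<dots> = (\<Sum>w\<in>S \<inter> words n. measure \<mu> {z. window z (length w) \<in> {w}})"
    by (intro finite_measure_finite_Union) (auto simp: disjoint_family_on_def window_eq_sets)
  finally show ?thesis by (simp add: mass_def)
qed

lemma measure_window_append:
  "measure \<mu> {z. window z m \<in> S \<and> window ((shift ^^ m) z) n \<in> T} =
    (\<Sum>u\<in>S \<inter> words m. \<Sum>v\<in>T \<inter> words n. mass (u @ v))"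
proof -
  have "{z. window z m \<in> S \<and> window ((shift ^^ m) z) n \<in> T} =
      {z. window z (m + n) \<in> {w. take m w \<in> S \<and> drop m w \<in> T}}"
    by (auto simp: window_add)
  then have "measure \<mu> {z. window z m \<in> S \<and> window ((shift ^^ m) z) n \<in> T} =
    (\<Sum>w\<in>words (m + n). if take m w \<in> S \<and> drop m w \<in> T then mass w else 0)"
    by (simp only: measure_window) (intro sum.mono_neutral_cong_left, auto)
  also have "\<dots> = (\<Sum>u\<in>words m. \<Sum>v\<in>words n. if u \<in> S \<and> v \<in> T then mass (u @ v) else 0)"
    by (simp add: sum_words_append)
  also have "\<dots> = (\<Sum>u\<in>words m. if u \<in> S then (\<Sum>v\<in>T \<inter> words n. mass (u @ v)) else 0)"
    by (intro sum.cong refl) (auto intro!: sum.mono_neutral_cong_right split: if_splits)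
  also have "\<dots> = (\<Sum>u\<in>S \<inter> words m. \<Sum>v\<in>T \<inter> words n. mass (u @ v))"
    by (intro sum.mono_neutral_cong_right) (auto split: if_splits)
  finally show ?thesis .
qed

lemma mass_sum_right: "(\<Sum>v\<in>words n. mass (u @ v)) = mass u"
proof -
  have "mass u = measure \<mu> {z. window z (length u) \<in> {u} \<and> window ((shift ^^ length u) z) n \<in> UNIV}"
    by (simp add: mass_def)
  also have "{u} \<inter> words (length u) = {u}" by auto
  then have "measure \<mu> {z. window z (length u) \<in> {u} \<and> window ((shift ^^ length u) z) n \<in> UNIV}
      = (\<Sum>v\<in>words n. mass (u @ v))"
    by (subst measure_window_append) simp
  finally show ?thesis ..
qed

lemma mass_sum_left: "(\<Sum>u\<in>words n. mass (u @ v)) = mass v"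
proof -
  have "mass v = measure \<mu> ((shift ^^ n) -` {z. window z (length v) \<in> {v}})"
    by (subst vimage_funpow_shift(2)) (auto simp: mass_def window_eq_sets)
  also have "\<dots> = measure \<mu> {z. window z n \<in> UNIV \<and> window ((shift ^^ n) z) (length v) \<in> {v}}"
    by (rule arg_cong[where f = "measure \<mu>"]) auto
  also have "\<dots> = (\<Sum>u\<in>words n. mass (u @ v))"
  proof -
    have "{v} \<inter> words (length v) = {v}" by auto
    then show ?thesis by (subst measure_window_append) simp
  qed
  finally show ?thesis ..
qed

lemma measure_window_gap:
  "measure \<mu> {z. window z m \<in> S \<and> window ((shift ^^ (m + k)) z) n \<in> T} =
    (\<Sum>u\<in>S \<inter> words m. \<Sum>v\<in>T \<inter> words n. \<Sum>c\<in>words k. mass (u @ c @ v))"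
proof -
  have drop_window: "drop k (window ((shift ^^ m) z) (k + n)) = window ((shift ^^ (m + k)) z) n"
    for z :: "int \<Rightarrow> 'a"
    by (rule nth_equalityI) (auto simp: funpow_shift algebra_simps)
  have "{z. window z m \<in> S \<and> window ((shift ^^ (m + k)) z) n \<in> T} =
     {z. window z m \<in> S \<and> window ((shift ^^ m) z) (k + n) \<in> {w. drop k w \<in> T}}"
    using drop_window by auto
  then have "measure \<mu> {z. window z m \<in> S \<and> window ((shift ^^ (m + k)) z) n \<in> T} =
      (\<Sum>u\<in>S \<inter> words m. \<Sum>w\<in>{w. drop k w \<in> T} \<inter> words (k + n). mass (u @ w))"
    by (simp only: measure_window_append)
  also have "\<dots> = (\<Sum>u\<in>S \<inter> words m. \<Sum>w\<in>words (k + n). if drop k w \<in> T then mass (u @ w) else 0)"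
    by (intro sum.cong refl sum.mono_neutral_cong_left) auto
  also have "\<dots> = (\<Sum>u\<in>S \<inter> words m. \<Sum>c\<in>words k. \<Sum>v\<in>words n. if v \<in> T then mass (u @ c @ v) else 0)"
    by (simp add: sum_words_append)
  also have "\<dots> = (\<Sum>u\<in>S \<inter> words m. \<Sum>c\<in>words k. \<Sum>v\<in>T \<inter> words n. mass (u @ c @ v))"
    by (intro sum.cong refl sum.mono_neutral_cong_right) (auto split: if_splits)
  also have "\<dots> = (\<Sum>u\<in>S \<inter> words m. \<Sum>v\<in>T \<inter> words n. \<Sum>c\<in>words k. mass (u @ c @ v))"
    by (intro sum.cong refl sum.swap)
  finally show ?thesis .
qed

text \<open>Windows start at coordinate 0, while events depend on negative coordinates too.
  Translating the event by \<open>k\<close> brings any finite set of coordinates into a window, and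
  invariance makes this harmless for measures.\<close>

definition window_approx :: "(int \<Rightarrow> 'a) set \<Rightarrow> real \<Rightarrow> nat \<Rightarrow> nat \<Rightarrow> 'a list set \<Rightarrow> bool" where
  "window_approx A e k n S \<longleftrightarrow> measure \<mu> (sym_diff ((shift ^^ k) -` A) {z. window z n \<in> S}) < e"

text \<open>A further translation by \<open>d\<close> puts the old window at position
  \<open>d\<close> of a longer one, and \<open>j\<close> pads on the right. With this freedom two
  approximations can be brought to the same translate and length.\<close>

lemma window_approx_enlarge:
  assumes "A \<in> sets \<mu>" "window_approx A e k n S"
  shows "\<exists>S'. window_approx A e (k + d) (d + n + j) S'"
proof -
  let ?D = "sym_diff ((shift ^^ k) -` A) {z. window z n \<in> S}"
  let ?S' = "{w. take n (drop d w) \<in> S}"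
  have "take n (drop d (window z (d + n + j))) = window ((shift ^^ d) z) n" for z :: "int \<Rightarrow> 'a"
    by (rule nth_equalityI) (auto simp: funpow_shift algebra_simps)
  then have "sym_diff ((shift ^^ (k + d)) -` A) {z. window z (d + n + j) \<in> ?S'} = (shift ^^ d) -` ?D"
    by (auto simp: funpow_add)
  moreover have "?D \<in> sets \<mu>"
    using assms vimage_funpow_shift(1) window_sets by blast
  ultimately have "window_approx A e (k + d) (d + n + j) ?S'"
    using assms(2) vimage_funpow_shift(2)[of ?D d] unfolding window_approx_def by metis
  then show ?thesis by blast
qed

lemma window_approx_Un:
  assumes A: "A \<in> sets \<mu>" "window_approx A e k n S" and B: "B \<in> sets \<mu>" "window_approx B e' k' n' S'"
  shows "\<exists>k n S. window_approx (A \<union> B) (e + e') k n S"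
proof -
  \<comment> \<open>Symmetric in the two approximations: each, enlarged by the data of the other,
    reaches the translate \<open>k + k'\<close> and this length.\<close>
  let ?n = "k' + n + (k + n')"
  obtain T where T: "window_approx A e (k + k') ?n T"
    using window_approx_enlarge[OF A] by blast
  obtain T' where T': "window_approx B e' (k' + k) (k + n' + (k' + n)) T'"
    using window_approx_enlarge[OF B] by blast
  have T'': "window_approx B e' (k + k') ?n T'"
    using T' by (simp add: ac_simps)
  let ?D = "sym_diff ((shift ^^ (k + k')) -` A) {z. window z ?n \<in> T}"
  let ?D' = "sym_diff ((shift ^^ (k + k')) -` B) {z. window z ?n \<in> T'}"
  have DD: "?D \<in> sets \<mu>" "?D' \<in> sets \<mu>"
    using A B vimage_funpow_shift(1) window_sets by blast+
  have "measure \<mu> (sym_diff ((shift ^^ (k + k')) -` (A \<union> B)) {z. window z ?n \<in> T \<union> T'}) \<le> measure \<mu> (?D \<union> ?D')"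
    using DD by (intro finite_measure_mono) auto
  also have "\<dots> \<le> measure \<mu> ?D + measure \<mu> ?D'"
    using DD by (rule measure_Un_le)
  also have "\<dots> < e + e'"
    using T T'' by (simp add: window_approx_def)
  finally have "window_approx (A \<union> B) (e + e') (k + k') ?n (T \<union> T')"
    by (simp add: window_approx_def)
  then show ?thesis by blast
qed

text \<open>The events approximable to every accuracy form a sigma-algebra: complementation leaves
  the symmetric difference unchanged, and a countable union is exhausted by finite ones up to
  \<open>e / 2\<close>.\<close>

lemma ex_window_approx:
  assumes "A \<in> sets \<mu>" "e > 0"
  shows "\<exists>k n S. window_approx A e k n S"
proof -
  let ?G = "{{z. z i \<in> X} | i X. True}"
  have seq_sets: "sets \<mu> = sigma_sets UNIV ?G"
    unfolding sets_eq seq_space_def sets_PiM_single by simp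
  have "\<forall>e>0. \<exists>k n S. window_approx A e k n S"
    using assms(1) unfolding seq_sets
  proof (induction rule: sigma_sets.induct)
    case (Basic A)
    then obtain i X where A: "A = {z. z i \<in> X}" by auto
    \<comment> \<open>Shifting by the absolute value of \<open>i\<close> moves coordinate
      \<open>i\<close> to coordinate \<open>j \<ge> 0\<close>, which a window of length
      \<open>j + 1\<close> sees.\<close>
    define j where "j = nat (i + int (nat \<bar>i\<bar>))"
    have "(shift ^^ nat \<bar>i\<bar>) -` A = {z. window z (Suc j) \<in> {w. w ! j \<in> X}}"
      by (auto simp: A funpow_shift j_def simp del: of_nat_Suc)
    then have "window_approx A e (nat \<bar>i\<bar>) (Suc j) {w. w ! j \<in> X}" if "e > 0" for e
      using that by (simp add: window_approx_def)
    then show ?case by blast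
  next
    case Empty
    have "window_approx {} e 0 0 {}" if "e > 0" for e
      using that by (simp add: window_approx_def)
    then show ?case by blast
  next
    case (Compl A)
    have "window_approx (UNIV - A) e k n (- S)" if "window_approx A e k n S" for e k n S
    proof -
      have "sym_diff ((shift ^^ k) -` (UNIV - A)) {z. window z n \<in> - S} =
          sym_diff ((shift ^^ k) -` A) {z. window z n \<in> S}" by auto
      with that show ?thesis by (simp add: window_approx_def)
    qed
    with Compl show ?case by blast
  next
    case (Union A)
    show ?case
    proof (intro allI impI)
      fix e :: real assume "e > 0"
      have A: "A i \<in> sets \<mu>" for i using Union(1) by (simp add: seq_sets)
      define B where "B j = (\<Union>i<j. A i)" for j
      have B: "B j \<in> sets \<mu>" for j unfolding B_def using A by auto
      have fin: "\<forall>e>0. \<exists>k n S. window_approx (B j) e k n S" for j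
      proof (induction j)
        case 0
        have "window_approx (B 0) e 0 0 {}" if "e > 0" for e
          using that by (simp add: window_approx_def B_def)
        then show ?case by blast
      next
        case (Suc j)
        show ?case
        proof (intro allI impI)
          fix e :: real assume "e > 0"
          then have "e / 2 > 0" by simp
          then obtain k n S k' n' S' where "window_approx (B j) (e/2) k n S" "window_approx (A j) (e/2) k' n' S'"
            using Suc Union(2)[of j] by meson
          from window_approx_Un[OF B this(1) A this(2)]
          show "\<exists>k n S. window_approx (B (Suc j)) e k n S"
            by (simp add: B_def lessThan_Suc Un_commute)
        qed
      qed
      have "(\<lambda>j. measure \<mu> (B j)) \<longlonglongrightarrow> measure \<mu> (\<Union>j. B j)"
        by (rule finite_Lim_measure_incseq) (use B in \<open>force simp: B_def incseq_def\<close>)+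
      moreover have UB: "(\<Union>j. B j) = (\<Union>i. A i)" by (auto simp: B_def)
      ultimately have "eventually (\<lambda>j. measure \<mu> (B j) > measure \<mu> (\<Union>i. A i) - e/2) sequentially"
        using \<open>e > 0\<close> by (intro order_tendstoD) auto
      then obtain j where j: "measure \<mu> (B j) > measure \<mu> (\<Union>i. A i) - e/2"
        by (auto simp: eventually_sequentially)
      have UA: "(\<Union>i. A i) \<in> sets \<mu>" using A by auto
      have sub: "B j \<subseteq> (\<Union>i. A i)" by (auto simp: B_def)
      let ?R = "(\<Union>i. A i) - B j"
      have R: "measure \<mu> ?R < e / 2"
        using j finite_measure_Diff[OF UA B sub] by simp
      from \<open>e > 0\<close> fin obtain k n S where S: "window_approx (B j) (e/2) k n S"
        by (meson half_gt_zero)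
      let ?W = "{z. window z n \<in> S}"
      have D: "sym_diff ((shift ^^ k) -` (B j)) ?W \<in> sets \<mu>" "?R \<in> sets \<mu>"
        using UA B vimage_funpow_shift(1)[OF B] window_sets by auto
      have "measure \<mu> (sym_diff ((shift ^^ k) -` (\<Union>i. A i)) ?W) \<le>
          measure \<mu> (sym_diff ((shift ^^ k) -` (B j)) ?W \<union> (shift ^^ k) -` ?R)"
        using D vimage_funpow_shift(1)[OF D(2)] sub by (intro finite_measure_mono) auto
      also have "\<dots> \<le> measure \<mu> (sym_diff ((shift ^^ k) -` (B j)) ?W) + measure \<mu> ((shift ^^ k) -` ?R)"
        using D vimage_funpow_shift(1)[OF D(2)] by (intro measure_Un_le)
      also have "\<dots> < e/2 + e/2"
        using S R vimage_funpow_shift(2)[OF D(2)] by (intro add_strict_mono) (auto simp: window_approx_def)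
      finally have "window_approx (\<Union>i. A i) e k n S" by (simp add: window_approx_def)
      then show "\<exists>k n S. window_approx (\<Union>i. A i) e k n S" by blast
    qed
  qed
  with \<open>e > 0\<close> show ?thesis by blast
qed

lemma measure_diff_le_sym_diff:
  assumes "A \<in> sets \<mu>" "B \<in> sets \<mu>"
  shows "\<bar>measure \<mu> A - measure \<mu> B\<bar> \<le> measure \<mu> (sym_diff A B)"
proof -
  have *: "measure \<mu> X \<le> measure \<mu> Y + measure \<mu> (sym_diff A B)"
    if "X \<in> sets \<mu>" "Y \<in> sets \<mu>" "X \<subseteq> Y \<union> sym_diff A B" for X Y
  proof -
    have D: "sym_diff A B \<in> sets \<mu>" using assms by auto
    have "measure \<mu> X \<le> measure \<mu> (Y \<union> sym_diff A B)"
      using that D by (intro finite_measure_mono) auto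
    also have "\<dots> \<le> measure \<mu> Y + measure \<mu> (sym_diff A B)"
      using that D by (intro measure_Un_le)
    finally show ?thesis .
  qed
  have "A \<subseteq> B \<union> sym_diff A B" "B \<subseteq> A \<union> sym_diff A B" by blast+
  with *[OF assms] *[OF assms(2,1)] show ?thesis by linarith
qed

section \<open>Almost invariant events and ergodicity\<close>

lemma sym_diff_funpow_null:
  assumes A: "A \<in> sets \<mu>" and null: "measure \<mu> (sym_diff (shift -` A) A) = 0"
  shows "measure \<mu> (sym_diff ((shift ^^ k) -` A) A) = 0"
proof (induction k)
  case (Suc k)
  let ?D = "sym_diff (shift -` A) A" and ?E = "sym_diff ((shift ^^ k) -` A) A"
  have D: "?D \<in> sets \<mu>" "?E \<in> sets \<mu>"
    using A vimage_shift_sets vimage_funpow_shift(1) by auto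
  have "measure \<mu> (sym_diff ((shift ^^ Suc k) -` A) A) \<le> measure \<mu> ((shift ^^ k) -` ?D \<union> ?E)"
    using D vimage_funpow_shift(1)[OF D(1)] by (intro finite_measure_mono) auto
  also have "\<dots> \<le> measure \<mu> ((shift ^^ k) -` ?D) + measure \<mu> ?E"
    using D vimage_funpow_shift(1)[OF D(1)] by (intro measure_Un_le)
  also have "\<dots> = 0"
    using null Suc vimage_funpow_shift(2)[OF D(1)] by simp
  finally show ?case
    by (intro antisym measure_nonneg)
qed simp

text \<open>If \<open>C\<close> is a window event close to an invariant set \<open>A\<close>, then \<open>C\<close> and a late translate of
  its complement are nearly disjoint, while the gluing bound makes them nearly independent.\<close>

lemma ergodic_of_gluing:
  assumes prob: "prob_space \<mu>" and "b > 0"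
    and glb: "\<And>u v. b * mass u * mass v \<le> (\<Sum>c\<in>words N. mass (u @ c @ v))"
    and A: "A \<in> sets \<mu>" and null: "measure \<mu> (sym_diff (shift -` A) A) = 0"
  shows "measure \<mu> A = 0 \<or> measure \<mu> A = 1"
proof (rule ccontr)
  interpret prob_space \<mu> by fact
  define a where "a = prob A"
  assume "\<not> ?thesis"
  then have a: "0 < a" "a < 1"
    using prob_le_1[of A] measure_nonneg[of \<mu> A] by (auto simp: a_def less_le)
  define m where "m = min a (1 - a)"
  have m: "0 < m" "m \<le> a" "m \<le> 1 - a" using a by (auto simp: m_def)
  \<comment> \<open>\<open>e \<le> m / 2\<close> keeps \<open>C\<close> and its complement at mass
    at least \<open>m / 2\<close>. The other bound makes near independence, at least
    \<open>b * (m/2)\<^sup>2\<close>, contradict near disjointness, below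
    \<open>2 * e\<close>.\<close>
  define e where "e = min (m / 2) (b * (m/2)\<^sup>2 / 4)"
  have e: "0 < e" "e \<le> m / 2" "4 * e \<le> b * (m/2)\<^sup>2"
    using m \<open>b > 0\<close> by (auto simp: e_def min_def field_simps)
  obtain k n S where S: "window_approx A e k n S"
    using ex_window_approx[OF A e(1)] by blast
  define C where "C = {z. window z n \<in> S}"
  have C [simp]: "C \<in> sets \<mu>" unfolding C_def by (rule window_sets)
  have Ak: "(shift ^^ k) -` A \<in> sets \<mu>" using A by (rule vimage_funpow_shift)
  \<comment> \<open>\<open>C\<close> approximates a translate of \<open>A\<close>; almost invariance
    replaces the translate by \<open>A\<close> itself.\<close>
  have AC: "prob (sym_diff A C) < e"
  proof -
    have "prob (sym_diff A C) \<le> prob (sym_diff ((shift ^^ k) -` A) A \<union> sym_diff ((shift ^^ k) -` A) C)"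
      using sets.Diff[OF A C] sets.Diff[OF C A] sets.Diff[OF A Ak] sets.Diff[OF Ak A]
        sets.Diff[OF Ak C] sets.Diff[OF C Ak]
      by (intro finite_measure_mono sets.Un) blast+
    also have "\<dots> \<le> prob (sym_diff ((shift ^^ k) -` A) A) + prob (sym_diff ((shift ^^ k) -` A) C)"
      using sets.Diff[OF A Ak] sets.Diff[OF Ak A] sets.Diff[OF Ak C] sets.Diff[OF C Ak]
      by (intro measure_Un_le sets.Un)
    also have "\<dots> < e"
      using sym_diff_funpow_null[OF A null] S by (simp add: window_approx_def C_def)
    finally show ?thesis .
  qed
  have pC: "prob C \<ge> m / 2" "1 - prob C \<ge> m / 2"
    using measure_diff_le_sym_diff[OF A C] AC e m by (auto simp: a_def abs_le_iff)
  define j where "j = n + N"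
  define D where "D = sym_diff A C"
  define Aj where "Aj = sym_diff ((shift ^^ j) -` A) A"
  have D: "D \<in> sets \<mu>"
    unfolding D_def by (intro sets.Un sets.Diff A C)
  have vD: "(shift ^^ j) -` D \<in> sets \<mu>"
    using D by (rule vimage_funpow_shift)
  have Aj: "Aj \<in> sets \<mu>"
    unfolding Aj_def by (intro sets.Un sets.Diff A vimage_funpow_shift(1))
  have "b * (m/2)\<^sup>2 \<le> b * (prob C * (1 - prob C))"
    unfolding power2_eq_square using pC m \<open>b > 0\<close> by (intro mult_left_mono mult_mono) auto
  also have "1 - prob C = prob {z. window z n \<in> - S}"
  proof -
    have "- C = {z. window z n \<in> - S}" by (auto simp: C_def)
    then show ?thesis using prob_compl[OF C] by (simp add: Compl_eq_Diff_UNIV)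
  qed
  also have "b * (prob C * prob {z. window z n \<in> - S}) =
      (\<Sum>u\<in>S \<inter> words n. \<Sum>v\<in>- S \<inter> words n. b * mass u * mass v)"
    unfolding C_def measure_window by (simp only: sum_product) (simp only: sum_distrib_left mult.assoc)
  also have "\<dots> \<le> (\<Sum>u\<in>S \<inter> words n. \<Sum>v\<in>- S \<inter> words n. \<Sum>c\<in>words N. mass (u @ c @ v))"
    by (intro sum_mono glb)
  also have "\<dots> = prob {z. window z n \<in> S \<and> window ((shift ^^ (n + N)) z) n \<in> - S}"
    by (rule measure_window_gap[symmetric])
  also have "{z. window z n \<in> S \<and> window ((shift ^^ (n + N)) z) n \<in> - S} = C \<inter> (shift ^^ j) -` (- C)"
    by (auto simp: C_def j_def)
  also have "prob \<dots> \<le> prob (D \<union> (shift ^^ j) -` D \<union> Aj)"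
  proof (rule finite_measure_mono)
    \<comment> \<open>If \<open>z\<close> is in \<open>C\<close> and its translate is not, then
      \<open>z\<close> is outside \<open>A\<close>, or the translate is in \<open>A\<close> but
      outside \<open>C\<close>, or membership in \<open>A\<close> was lost on the way.\<close>
    show "C \<inter> (shift ^^ j) -` (- C) \<subseteq> D \<union> (shift ^^ j) -` D \<union> Aj"
      by (auto simp: D_def Aj_def)
    show "D \<union> (shift ^^ j) -` D \<union> Aj \<in> sets \<mu>"
      using D vD Aj by (intro sets.Un)
  qed
  also have "\<dots> \<le> prob D + prob ((shift ^^ j) -` D) + prob Aj"
    using D vD Aj by (intro order_trans[OF measure_Un_le] add_right_mono measure_Un_le sets.Un)
  also have "\<dots> < 2 * e"
    using AC vimage_funpow_shift(2)[OF D] sym_diff_funpow_null[OF A null] by (simp add: D_def Aj_def)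
  finally show False using e by simp
qed

end

subsection \<open>Distinct ergodic measures are singular\<close>

text \<open>Serves as a dominating measure for densities, and lets one window event approximate a
  set for both measures at once.\<close>

definition sum_measure :: "'a measure \<Rightarrow> 'a measure \<Rightarrow> 'a measure" where
  "sum_measure p q = measure_of (space p) (sets p) (\<lambda>A. emeasure p A + emeasure q A)"

lemma sets_sum_measure [simp]: "sets (sum_measure p q) = sets p"
  by (simp add: sum_measure_def)

lemma space_sum_measure [simp]: "space (sum_measure p q) = space p"
  by (simp add: sum_measure_def)

lemma emeasure_sum_measure:
  assumes "sets q = sets p" "A \<in> sets p"
  shows "emeasure (sum_measure p q) A = emeasure p A + emeasure q A"
proof (rule emeasure_measure_of[OF sum_measure_def])
  show "countably_additive (sets (sum_measure p q)) (\<lambda>A. emeasure p A + emeasure q A)"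
  proof (rule countably_additiveI)
    fix B :: "nat \<Rightarrow> 'a set"
    assume B: "range B \<subseteq> sets (sum_measure p q)" "disjoint_family B"
    have "(\<Sum>i. emeasure p (B i) + emeasure q (B i)) = (\<Sum>i. emeasure p (B i)) + (\<Sum>i. emeasure q (B i))"
      by (rule suminf_add[symmetric]) auto
    with B assms(1) show "(\<Sum>i. emeasure p (B i) + emeasure q (B i)) = emeasure p (\<Union>i. B i) + emeasure q (\<Union>i. B i)"
      by (simp add: suminf_emeasure)
  qed
qed (use assms sets.space_closed in \<open>auto simp: positive_def\<close>)

lemma measure_sum_measure:
  assumes "sets q = sets p" "A \<in> sets p" "finite_measure p" "finite_measure q"
  shows "measure (sum_measure p q) A = measure p A + measure q A"
  using emeasure_sum_measure[OF assms(1,2)] finite_measure.emeasure_finite[OF assms(3), of A]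
    finite_measure.emeasure_finite[OF assms(4), of A]
  by (simp add: measure_def enn2real_plus less_top)

lemma finite_measure_sum_measure:
  assumes "sets q = sets p" "finite_measure p" "finite_measure q"
  shows "finite_measure (sum_measure p q)"
  by (rule finite_measureI)
    (use assms in \<open>simp add: emeasure_sum_measure finite_measure.emeasure_finite\<close>)

text \<open>\<open>A\<close> is where the density of \<open>p\<close> with respect to
  \<open>p + q\<close> exceeds 1/2, so \<open>p\<close> is strictly the denser measure there.
  Strictness makes every part of \<open>A\<close> on which \<open>p\<close> does not win null for
  both measures, which a Hahn decomposition with ties assigned arbitrarily would not
  guarantee.\<close>

lemma ex_strict_hahn:
  assumes sets: "sets q = sets p" and fin: "finite_measure p" "finite_measure q"
  obtains A where "A \<in> sets p"
    "\<And>B. B \<in> sets p \<Longrightarrow> B \<subseteq> A \<Longrightarrow> measure p B \<le> measure q B \<Longrightarrow> measure p B = 0 \<and> measure q B = 0"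
    "\<And>B. B \<in> sets p \<Longrightarrow> B \<inter> A = {} \<Longrightarrow> measure p B \<le> measure q B"
proof -
  let ?L = "sum_measure p q"
  interpret p: finite_measure p by fact
  interpret q: finite_measure q by fact
  interpret L: finite_measure ?L by (rule finite_measure_sum_measure) fact+
  have L: "emeasure ?L B = emeasure p B + emeasure q B" if "B \<in> sets p" for B
    using that sets by (rule emeasure_sum_measure[rotated])
  have "absolutely_continuous ?L p"
    unfolding absolutely_continuous_def by (auto simp: null_sets_def L)
  from L.Radon_Nikodym[OF this] obtain f where
    f [measurable]: "f \<in> borel_measurable ?L" and dens: "density ?L f = p" by auto
  define A where "A = {x \<in> space ?L. f x > ennreal (1/2)}"
  have A: "A \<in> sets p"
  proof -
    have "{x \<in> space ?L. f x > ennreal (1/2)} \<in> sets ?L" by measurable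
    then show ?thesis by (simp add: A_def)
  qed
  have pB: "emeasure p B = (\<integral>\<^sup>+x. f x * indicator B x \<partial>?L)" if "B \<in> sets p" for B
    using that emeasure_density[OF f, of B] by (simp add: dens)
  have LB: "ennreal (1/2) * emeasure ?L B = (\<integral>\<^sup>+x. ennreal (1/2) * indicator B x \<partial>?L)" if "B \<in> sets p" for B
    using that by (simp add: nn_integral_cmult_indicator)
  have half: "ennreal (1/2) * emeasure ?L B = ennreal ((measure p B + measure q B) / 2)"
    if "B \<in> sets p" for B
    unfolding L[OF that] p.emeasure_eq_measure q.emeasure_eq_measure
    by (subst ennreal_plus[symmetric], simp, simp, subst ennreal_mult'[symmetric]) simp_all
  show thesis
  proof (rule that[OF A])
    fix B assume B: "B \<in> sets p" "B \<subseteq> A" "measure p B \<le> measure q B"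
    have [measurable]: "B \<in> sets ?L" using B(1) by simp
    have "emeasure ?L B = 0"
    proof (rule ccontr)
      assume pos: "emeasure ?L B \<noteq> 0"
      have "ennreal (1/2) * emeasure ?L B < emeasure p B"
        unfolding pB[OF B(1)] LB[OF B(1)]
      proof (rule nn_integral_less)
        show "(\<integral>\<^sup>+x. ennreal (1/2) * indicator B x \<partial>?L) \<noteq> \<infinity>"
          unfolding LB[OF B(1), symmetric] half[OF B(1)] by simp
        show "AE x in ?L. ennreal (1/2) * indicator B x \<le> f x * indicator B x"
          using B(2) by (intro AE_I2) (auto simp: A_def indicator_def)
        show "\<not> (AE x in ?L. f x * indicator B x \<le> ennreal (1/2) * indicator B x)"
        proof
          assume "AE x in ?L. f x * indicator B x \<le> ennreal (1/2) * indicator B x"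
          then have "AE x in ?L. x \<notin> B"
            by eventually_elim (use B(2) in \<open>auto simp: A_def indicator_def not_le split: if_splits\<close>)
          then have "B \<in> null_sets ?L"
            using B(1) by (subst (asm) AE_iff_null_sets[symmetric]) auto
          with pos show False by auto
        qed
      qed measurable
      then have "(measure p B + measure q B) / 2 < measure p B"
        unfolding half[OF B(1)] p.emeasure_eq_measure by (simp add: ennreal_less_iff)
      with B(3) show False by simp
    qed
    then show "measure p B = 0 \<and> measure q B = 0"
      using L[OF B(1)] by (simp add: measure_def)
  next
    fix B assume B: "B \<in> sets p" "B \<inter> A = {}"
    have "B \<subseteq> space ?L" using B sets.sets_into_space by auto
    then have "emeasure p B \<le> ennreal (1/2) * emeasure ?L B"
      unfolding pB[OF B(1)] LB[OF B(1)] using B(2)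
      by (intro nn_integral_mono) (auto simp: A_def indicator_def not_less)
    then have "measure p B \<le> (measure p B + measure q B) / 2"
      unfolding half[OF B(1)] p.emeasure_eq_measure by (simp add: ennreal_le_iff)
    then show "measure p B \<le> measure q B" by simp
  qed
qed

text \<open>The strict Hahn set is almost invariant. The points entering and those leaving
  \<open>A\<close> under the shift have equal mass, for either measure. One of these sets lies off
  \<open>A\<close>, so \<open>p \<le> q\<close> there and hence on the other, which lies inside
  \<open>A\<close> and is therefore null. Ergodicity then leaves only the masses 0 and 1.\<close>

lemma ex_singular_set:
  fixes p q :: "(int \<Rightarrow> 'a::finite) measure"
  assumes p: "invariant_measure p" "prob_space p" and q: "invariant_measure q" "prob_space q"
    and erg_p: "\<And>A. A \<in> sets p \<Longrightarrow> measure p (sym_diff (shift -` A) A) = 0 \<Longrightarrow> measure p A = 0 \<or> measure p A = 1"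
    and erg_q: "\<And>A. A \<in> sets q \<Longrightarrow> measure q (sym_diff (shift -` A) A) = 0 \<Longrightarrow> measure q A = 0 \<or> measure q A = 1"
    and "p \<noteq> q"
  obtains A where "A \<in> sets p" "measure p A = 1" "measure q A = 0"
proof -
  interpret p: invariant_measure p by fact
  interpret q: invariant_measure q by fact
  interpret pp: prob_space p by fact
  interpret qq: prob_space q by fact
  have sets [simp]: "sets q = sets p" by (simp add: p.sets_eq q.sets_eq)
  obtain A where A: "A \<in> sets p"
    and pos: "\<And>B. B \<in> sets p \<Longrightarrow> B \<subseteq> A \<Longrightarrow> measure p B \<le> measure q B \<Longrightarrow> measure p B = 0 \<and> measure q B = 0"
    and neg: "\<And>B. B \<in> sets p \<Longrightarrow> B \<inter> A = {} \<Longrightarrow> measure p B \<le> measure q B"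
    using ex_strict_hahn[OF sets p.finite_measure_axioms q.finite_measure_axioms] by metis
  define A' where "A' = shift -` A"
  have A': "A' \<in> sets p" unfolding A'_def using A by (rule p.vimage_shift_sets)
  have inv: "measure p A' = measure p A" "measure q A' = measure q A"
    using p.vimage_funpow_shift(2)[of A 1] q.vimage_funpow_shift(2)[of A 1] A by (simp_all add: A'_def)
  have split: "measure \<nu> X = measure \<nu> (X \<inter> Y) + measure \<nu> (X - Y)"
    if "finite_measure \<nu>" "sets \<nu> = sets p" "X \<in> sets p" "Y \<in> sets p" for \<nu> X Y
    using finite_measure.finite_measure_Union[OF that(1), of "X \<inter> Y" "X - Y"] that
    by (simp add: Int_Diff_Un) blast
  have eq: "measure p (A - A') = measure p (A' - A)" "measure q (A - A') = measure q (A' - A)"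
    using split[OF p.finite_measure_axioms refl A A'] split[OF p.finite_measure_axioms refl A' A]
      split[OF q.finite_measure_axioms sets A A'] split[OF q.finite_measure_axioms sets A' A] inv
    by (simp_all add: Int_commute)
  have "measure p (A' - A) \<le> measure q (A' - A)"
    using A A' by (intro neg) auto
  then have "measure p (A - A') = 0 \<and> measure q (A - A') = 0"
    using A A' eq by (intro pos) auto
  then have null: "measure p (sym_diff A' A) = 0" "measure q (sym_diff A' A) = 0"
    using eq A A' measure_Un_le[of "A' - A" p "A - A'"] measure_Un_le[of "A' - A" q "A - A'"]
      measure_nonneg[of p "sym_diff A' A"] measure_nonneg[of q "sym_diff A' A"] by auto
  \<comment> \<open>Otherwise \<open>A\<close> is null for both measures and
    \<open>p \<le> q\<close> on every event; passing to complements, with both total masses 1,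
    forces \<open>p = q\<close>.\<close>
  have "\<not> measure p A \<le> measure q A"
  proof
    assume "measure p A \<le> measure q A"
    with pos[OF A subset_refl] have zero: "measure p A = 0" "measure q A = 0" by auto
    have le: "measure p B \<le> measure q B" if B: "B \<in> sets p" for B
    proof -
      have "measure p (B \<inter> A) \<le> measure p A"
        using A B by (intro p.finite_measure_mono) auto
      then have "measure p B = measure p (B - A)"
        using split[OF p.finite_measure_axioms refl B A] zero measure_nonneg[of p "B \<inter> A"] by linarith
      also have "\<dots> \<le> measure q (B - A)"
        using A B by (intro neg) auto
      also have "\<dots> \<le> measure q B"
        using A B by (intro q.finite_measure_mono) auto
      finally show ?thesis .
    qed
    have "p = q"
    proof (rule measure_eqI)
      fix B assume B: "B \<in> sets p"
      have "measure p (UNIV - B) \<le> measure q (UNIV - B)"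
        using B p.compl_sets[OF B] by (intro le) (auto simp: Compl_eq_Diff_UNIV)
      then have "measure q B \<le> measure p B"
        using B pp.prob_compl[OF B] qq.prob_compl[of B] by simp
      with le[OF B] show "emeasure p B = emeasure q B"
        by (simp add: p.emeasure_eq_measure q.emeasure_eq_measure)
    qed simp
    with \<open>p \<noteq> q\<close> show False ..
  qed
  with erg_p[OF A] erg_q[of A] null A have "measure p A = 1" "measure q A = 0"
    by (auto simp: A'_def)
  with A show thesis by (rule that)
qed

subsection \<open>Exponential decay of the Hellinger affinity\<close>

lemma sum_sqrt_le:
  fixes a b :: "'a \<Rightarrow> real"
  assumes "\<And>x. a x \<ge> 0" "\<And>x. b x \<ge> 0"
  shows "(\<Sum>x\<in>S. sqrt (a x * b x)) \<le> sqrt (sum a S * sum b S)"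
proof -
  have "(\<Sum>x\<in>S. \<bar>sqrt (a x)\<bar> * \<bar>sqrt (b x)\<bar>) \<le> L2_set (\<lambda>x. sqrt (a x)) S * L2_set (\<lambda>x. sqrt (b x)) S"
    by (rule L2_set_mult_ineq)
  then show ?thesis using assms by (simp add: L2_set_def real_sqrt_mult)
qed

text \<open>A window event close to the separating set splits the words into a part where
  \<open>q\<close> is small and a part where \<open>p\<close> is small; Cauchy-Schwarz bounds the
  affinity on each part.\<close>

lemma ex_affinity_less:
  fixes p q :: "(int \<Rightarrow> 'a::finite) measure"
  assumes p: "invariant_measure p" "prob_space p" and q: "invariant_measure q" "prob_space q"
    and A: "A \<in> sets p" "measure p A = 1" "measure q A = 0" and "\<epsilon> > 0"
  shows "\<exists>n. (\<Sum>w\<in>words n. sqrt (invariant_measure.mass p w * invariant_measure.mass q w)) < \<epsilon>"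
proof -
  interpret p: invariant_measure p by fact
  interpret q: invariant_measure q by fact
  interpret pp: prob_space p by fact
  interpret qq: prob_space q by fact
  have sets [simp]: "sets q = sets p" by (simp add: p.sets_eq q.sets_eq)
  interpret L: invariant_measure "sum_measure p q"
  proof (intro invariant_measure.intro invariant_measure_axioms.intro)
    show "finite_measure (sum_measure p q)"
      by (rule finite_measure_sum_measure) (simp_all add: p.finite_measure_axioms q.finite_measure_axioms)
    show "sets (sum_measure p q) = sets seq_space"
      by (simp add: p.sets_eq)
  qed (use p.inv q.inv p.vimage_shift_sets in \<open>simp add: emeasure_sum_measure\<close>)
  \<comment> \<open>Each of the two parts contributes at most
    \<open>sqrt e = \<epsilon> / 3\<close>, which leaves room for a strict bound.\<close>
  define e where "e = (\<epsilon> / 3)\<^sup>2"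
  have e: "e > 0" "sqrt e = \<epsilon> / 3" using \<open>\<epsilon> > 0\<close> by (auto simp: e_def)
  obtain k n S where S: "L.window_approx A e k n S"
    using L.ex_window_approx[of A e] A(1) e by auto
  let ?A = "(shift ^^ k) -` A"
  define C where "C = {z :: int \<Rightarrow> 'a. window z n \<in> S}"
  have C: "C \<in> sets p" unfolding C_def by (rule p.window_sets)
  have kA: "?A \<in> sets p" "measure p ?A = 1" "measure q ?A = 0"
    using p.vimage_funpow_shift[OF A(1), of k] q.vimage_funpow_shift(2)[of A k] A by simp_all
  have "measure p (sym_diff ?A C) + measure q (sym_diff ?A C) < e"
    using S kA C unfolding L.window_approx_def C_def[symmetric]
    by (subst (asm) measure_sum_measure) (simp_all add: p.finite_measure_axioms q.finite_measure_axioms)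
  then have "measure p (sym_diff ?A C) < e" "measure q (sym_diff ?A C) < e"
    using measure_nonneg[of p "sym_diff ?A C"] measure_nonneg[of q "sym_diff ?A C"] by linarith+
  then have pC: "1 - measure p C < e" and qC: "measure q C < e"
    using p.measure_diff_le_sym_diff[OF kA(1) C] q.measure_diff_le_sym_diff[of ?A C] kA C by auto
  have pS: "sum p.mass (S \<inter> words n) = measure p C" "sum q.mass (S \<inter> words n) = measure q C"
    by (simp_all add: C_def p.measure_window q.measure_window)
  have C': "- C = {z. window z n \<in> - S}" by (auto simp: C_def)
  have pS': "sum p.mass (- S \<inter> words n) = 1 - measure p C" "sum q.mass (- S \<inter> words n) = 1 - measure q C"
    unfolding p.measure_window[symmetric] q.measure_window[symmetric] C'[symmetric]
    using pp.prob_compl[OF C] qq.prob_compl[of C] C by (simp_all add: Compl_eq_Diff_UNIV)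
  have "(\<Sum>w\<in>words n. sqrt (p.mass w * q.mass w)) =
      (\<Sum>w\<in>S \<inter> words n. sqrt (p.mass w * q.mass w)) + (\<Sum>w\<in>- S \<inter> words n. sqrt (p.mass w * q.mass w))"
    by (subst sum.union_disjoint[symmetric]) (auto intro!: sum.cong)
  also have "\<dots> \<le> sqrt (measure p C * measure q C) + sqrt ((1 - measure p C) * (1 - measure q C))"
    using sum_sqrt_le[of p.mass q.mass "S \<inter> words n"] sum_sqrt_le[of p.mass q.mass "- S \<inter> words n"]
    by (simp add: pS pS')
  also have "\<dots> \<le> sqrt (1 * e) + sqrt (e * 1)"
    using pC qC e(1) by (intro add_mono real_sqrt_le_mono mult_mono) auto
  also have "\<dots> < \<epsilon>" using e \<open>\<epsilon> > 0\<close> by simp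
  finally show ?thesis by blast
qed

text \<open>A Fekete-type argument: one length \<open>n0\<close> at which the sum beats the constant
  \<open>B\<close> gives geometric decay along the multiples of \<open>n0\<close>, and remainders
  cost only a factor.\<close>

lemma submultiplicative_sum_decay:
  fixes h :: "'a::finite list \<Rightarrow> real"
  assumes h0: "\<And>u. h u \<ge> 0" and sub: "\<And>u v. h (u @ v) \<le> B * h u * h v" and "B \<ge> 0"
    and le1: "\<And>n. sum h (words n) \<le> 1" and n0: "n0 > 0" "B * sum h (words n0) < 1"
  obtains C \<rho> where "0 < \<rho>" "\<rho> < 1" "\<And>n. sum h (words n) \<le> C * \<rho> ^ n"
proof -
  define S where "S n = sum h (words n)" for n
  have S0: "S n \<ge> 0" for n unfolding S_def using h0 by (simp add: sum_nonneg)
  have sub_S: "S (m + n) \<le> B * S m * S n" for m n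
  proof -
    have "S (m + n) \<le> (\<Sum>u\<in>words m. \<Sum>v\<in>words n. B * h u * h v)"
      unfolding S_def sum_words_append by (intro sum_mono sub)
    also have "\<dots> = B * S m * S n"
      unfolding S_def by (simp only: mult.assoc sum_product) (simp only: sum_distrib_left)
    finally show ?thesis .
  qed
  \<comment> \<open>The maximum with 1/2 keeps \<open>\<beta>\<close> positive even if the sum
    vanishes, so that \<open>1 / \<beta>\<close> is meaningful below.\<close>
  define \<beta> where "\<beta> = max (B * S n0) (1/2)"
  have \<beta>: "0 < \<beta>" "\<beta> < 1" "B * S n0 \<le> \<beta>" using n0 by (auto simp: \<beta>_def S_def)
  have pow: "S (k * n0 + r) \<le> \<beta> ^ k" for k r
  proof (induction k)
    case (Suc k)
    have "S (Suc k * n0 + r) = S (n0 + (k * n0 + r))" by (simp add: ac_simps)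
    also have "\<dots> \<le> B * S n0 * S (k * n0 + r)" by (rule sub_S)
    also have "\<dots> \<le> \<beta> * \<beta> ^ k" using Suc \<beta> S0 by (intro mult_mono) auto
    finally show ?case by simp
  qed (use le1 in \<open>simp add: S_def\<close>)
  define \<rho> where "\<rho> = root n0 \<beta>"
  have \<rho>: "0 < \<rho>" "\<rho> < 1" "\<rho> ^ n0 = \<beta>"
    unfolding \<rho>_def using \<beta> n0 real_root_lt_1_iff[of n0 \<beta>] by auto
  have "S n \<le> (1 / \<beta>) * \<rho> ^ n" for n
  proof -
    have "S n = S ((n div n0) * n0 + n mod n0)" by simp
    also have "\<dots> \<le> \<beta> ^ (n div n0)" by (rule pow)
    \<comment> \<open>The length is rounded up to the next multiple of \<open>n0\<close>, at the
      price of one factor \<open>1 / \<beta>\<close>.\<close>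
    also have "\<dots> = (1 / \<beta>) * \<rho> ^ (n0 * Suc (n div n0))"
      using \<beta> \<rho> by (simp only: power_mult) simp
    also have "\<dots> \<le> (1 / \<beta>) * \<rho> ^ n"
    proof (intro mult_left_mono power_decreasing)
      show "n \<le> n0 * Suc (n div n0)"
        using n0 dividend_less_times_div[of n0 n] by simp
    qed (use \<beta> \<rho> in auto)
    finally show ?thesis .
  qed
  with \<rho> that[of \<rho> "1 / \<beta>"] show thesis by (simp add: S_def)
qed

text \<open>A word of length \<open>n\<close> violating the bound has an affinity summand of at
  least \<open>sqrt \<rho> ^ n\<close> times its \<open>p\<close>-mass. So half of the rate pays for
  the threshold, and the other half makes the probabilities of violation summable.\<close>

lemma AE_mass_ratio_le:
  fixes p q :: "(int \<Rightarrow> 'a::finite) measure"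
  assumes p: "invariant_measure p" and q: "invariant_measure q"
    and \<rho>: "0 < \<rho>" "\<rho> < 1"
    and decay: "\<And>n. (\<Sum>w\<in>words n. sqrt (invariant_measure.mass p w * invariant_measure.mass q w)) \<le> C * \<rho> ^ n"
  shows "AE y in p. eventually (\<lambda>n. invariant_measure.mass q (window y n)
      \<le> \<rho> ^ n * invariant_measure.mass p (window y n)) sequentially"
proof -
  interpret p: invariant_measure p by fact
  interpret q: invariant_measure q by fact
  define s where "s = sqrt \<rho>"
  have s: "0 < s" "s < 1" "s * s = \<rho>" using \<rho> by (auto simp: s_def)
  define bad where "bad n = {w. q.mass w > \<rho> ^ n * p.mass w}" for n
  define A where "A n = {y. window y n \<in> bad n}" for n
  have A: "A n \<in> sets p" for n unfolding A_def by (rule p.window_sets)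
  have le: "measure p (A n) \<le> C * s ^ n" for n
  proof -
    have "s ^ n * p.mass w \<le> sqrt (p.mass w * q.mass w)" if "w \<in> bad n" for w
    proof (rule real_le_rsqrt)
      have "(s ^ n * p.mass w)\<^sup>2 = p.mass w * (\<rho> ^ n * p.mass w)"
        by (simp add: power2_eq_square power_mult_distrib ac_simps flip: s(3))
      also have "\<dots> \<le> p.mass w * q.mass w"
        using that by (intro mult_left_mono) (auto simp: bad_def)
      finally show "(s ^ n * p.mass w)\<^sup>2 \<le> p.mass w * q.mass w" .
    qed
    then have "s ^ n * measure p (A n) \<le> (\<Sum>w\<in>bad n \<inter> words n. sqrt (p.mass w * q.mass w))"
      unfolding A_def p.measure_window sum_distrib_left by (intro sum_mono) auto
    also have "\<dots> \<le> (\<Sum>w\<in>words n. sqrt (p.mass w * q.mass w))"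
      by (intro sum_mono2) auto
    also have "\<dots> \<le> s ^ n * (C * s ^ n)"
      using decay[of n] by (simp add: power_mult_distrib ac_simps flip: s(3))
    finally show ?thesis using s by simp
  qed
  have "AE y in p. eventually (\<lambda>n. y \<in> space p - A n) sequentially"
  proof (rule borel_cantelli_AE1)
    show "A n \<in> sets p" for n by (rule A)
    show "emeasure p (A n) < \<infinity>" for n
      unfolding infinity_ennreal_def less_top[symmetric] by (rule p.emeasure_finite)
    show "summable (\<lambda>n. measure p (A n))"
      by (rule summable_comparison_test'[of "\<lambda>n. C * s ^ n" 0])
        (use le s in \<open>auto intro!: summable_mult summable_geometric\<close>)
  qed
  then show ?thesis
    by eventually_elim (auto simp: A_def bad_def not_less elim!: eventually_mono)
qed

subsection \<open>Gibbs measures\<close>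

definition weight :: "((int \<Rightarrow> 'a) \<Rightarrow> real) \<Rightarrow> real \<Rightarrow> (int \<Rightarrow> 'a) \<Rightarrow> nat \<Rightarrow> real" where
  "weight f P x n = exp (birkhoff f x n - real n * P)"

lemma weight_pos [simp]: "weight f P x n > 0"
  by (simp add: weight_def)

lemma weight_nonneg [simp]: "weight f P x n \<ge> 0"
  by (simp add: weight_def)

lemma weight_0 [simp]: "weight f P x 0 = 1"
  by (simp add: weight_def)

lemma weight_add: "weight f P x (m + n) = weight f P x m * weight f P ((shift ^^ m) x) n"
  by (simp add: weight_def birkhoff_add algebra_simps flip: exp_add)

lemma abs_birkhoff_le:
  assumes "\<And>k. \<bar>f ((shift ^^ k) x)\<bar> \<le> M"
  shows "\<bar>birkhoff f x n\<bar> \<le> real n * M"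
proof -
  have "\<bar>birkhoff f x n\<bar> \<le> (\<Sum>k<n. \<bar>f ((shift ^^ k) x)\<bar>)"
    unfolding birkhoff_def by (rule sum_abs)
  also have "\<dots> \<le> (\<Sum>k<n. M)" by (intro sum_mono assms)
  finally show ?thesis by simp
qed

lemma birkhoff_diff: "birkhoff (\<lambda>x. f x - g x) x n = birkhoff f x n - birkhoff g x n"
  by (simp add: birkhoff_def sum_subtractf)

lemma weight_ge:
  assumes "\<And>k. \<bar>f ((shift ^^ k) x)\<bar> \<le> M"
  shows "weight f P x n \<ge> exp (- real n * (M + \<bar>P\<bar>))"
proof -
  have "real n * P \<le> real n * \<bar>P\<bar>" by (intro mult_left_mono) auto
  with abs_birkhoff_le[of f x M n, OF assms] show ?thesis
    by (simp add: weight_def algebra_simps)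
qed

text \<open>The Gibbs inequalities, cleared of denominators and extended to \<open>n = 0\<close>,
  which \<open>K \<ge> 1\<close> permits; words may then be cut anywhere.\<close>

locale gibbs_state = glued_shift Z N + invariant_measure \<mu>
  for Z :: "(int \<Rightarrow> 'a::finite) set" and N and \<mu> :: "(int \<Rightarrow> 'a) measure" +
  fixes f :: "(int \<Rightarrow> 'a) \<Rightarrow> real" and K P :: real
  assumes prob: "prob_space \<mu>" and Z_sets: "Z \<in> sets \<mu>" and Z_full: "measure \<mu> Z = 1"
    and K_ge_1: "K \<ge> 1"
    and upper: "\<And>x n. x \<in> Z \<Longrightarrow> measure \<mu> (cyl Z x n) \<le> K * weight f P x n"
    and lower: "\<And>x n. x \<in> Z \<Longrightarrow> weight f P x n \<le> K * measure \<mu> (cyl Z x n)"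

lemma gibbs_measure_state:
  assumes "glued_shift Z N" "gibbs_measure Z f \<mu>"
  obtains K P where "gibbs_state Z N \<mu> f K P"
proof -
  from assms(2) have sets: "sets \<mu> = sets seq_space" and prob: "prob_space \<mu>"
    and Z: "Z \<in> sets \<mu>" "emeasure \<mu> Z = 1"
    and inv: "\<And>A. A \<in> sets \<mu> \<Longrightarrow> emeasure \<mu> (shift -` A) = emeasure \<mu> A"
    unfolding gibbs_measure_def by blast+
  from assms(2) obtain K P where "K > 0" and bounds: "\<forall>x\<in>Z. \<forall>m\<ge>1.
      inverse K \<le> measure \<mu> (cyl Z x m) / exp (- real m * P + (\<Sum>k<m. f ((shift ^^ k) x))) \<and>
      measure \<mu> (cyl Z x m) / exp (- real m * P + (\<Sum>k<m. f ((shift ^^ k) x))) \<le> K"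
    unfolding gibbs_measure_def by blast
  have "weight f P x m = exp (- real m * P + (\<Sum>k<m. f ((shift ^^ k) x)))" for x m
    by (simp add: weight_def birkhoff_def)
  then have K: "inverse K \<le> measure \<mu> (cyl Z x m) / weight f P x m \<and> measure \<mu> (cyl Z x m) / weight f P x m \<le> K"
    if "x \<in> Z" "m \<ge> 1" for x m
    using bounds that by simp
  interpret glued_shift Z N by fact
  interpret prob_space \<mu> by fact
  have Z1: "measure \<mu> Z = 1" using Z by (simp add: measure_def)
  have "Z \<noteq> {}" using Z1 by auto
  then obtain x where "x \<in> Z" by blast
  from K[OF this, of 1] have "inverse K \<le> K" by auto
  moreover have "1 < inverse K" if "K < 1"
    using that \<open>K > 0\<close> by (rule one_less_inverse[rotated])
  ultimately have "K \<ge> 1" by fastforce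
  have bounds: "measure \<mu> (cyl Z x n) \<le> K * weight f P x n \<and> weight f P x n \<le> K * measure \<mu> (cyl Z x n)"
    if "x \<in> Z" for x n
  proof (cases "n = 0")
    case True
    then show ?thesis using \<open>K \<ge> 1\<close> Z1 by (simp add: cyl_def)
  next
    case False
    then show ?thesis using K[OF that, of n] \<open>K > 0\<close> by (simp add: field_simps)
  qed
  have "gibbs_state Z N \<mu> f K P"
    by unfold_locales (use sets inv prob Z Z1 \<open>K \<ge> 1\<close> bounds in auto)
  then show thesis by (rule that)
qed

context gibbs_state
begin

text \<open>\<open>mass\<close> ignores \<open>Z\<close>, so that its marginal identities hold for
  all words, whereas cylinders are cut down to \<open>Z\<close>. The two agree because
  \<open>Z\<close> has full measure.\<close>

lemma mass_eq_Int: "mass w = measure \<mu> {z \<in> Z. window z (length w) = w}"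
proof -
  interpret prob_space \<mu> by (rule prob)
  have "AE z in \<mu>. z \<in> Z"
    using Z_full Z_sets prob_eq_1 by blast
  then show ?thesis
    unfolding mass_def using Z_sets window_eq_sets[of "length w" w]
    by (intro measure_eq_AE) (auto simp: Collect_conj_eq elim!: eventually_mono)
qed

lemma cyl_eq_mass: "measure \<mu> (cyl Z x n) = mass (window x n)"
  by (simp add: mass_eq_Int cyl_eq_window)

lemma mass_not_realized: "\<not> (\<exists>x\<in>Z. window x (length w) = w) \<Longrightarrow> mass w = 0"
proof -
  assume "\<not> (\<exists>x\<in>Z. window x (length w) = w)"
  then have "{z \<in> Z. window z (length w) = w} = {}" by blast
  then show "mass w = 0" unfolding mass_eq_Int by (simp only: measure_empty)
qed

lemma mass_upper: "x \<in> Z \<Longrightarrow> mass (window x n) \<le> K * weight f P x n"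
  using upper by (simp add: cyl_eq_mass)

lemma mass_lower: "x \<in> Z \<Longrightarrow> weight f P x n \<le> K * mass (window x n)"
  using lower by (simp add: cyl_eq_mass)

lemma mass_pos: "x \<in> Z \<Longrightarrow> mass (window x n) > 0"
proof -
  assume "x \<in> Z"
  from less_le_trans[OF weight_pos mass_lower[OF this]] have "0 < K * mass (window x n)" .
  then show ?thesis using K_ge_1 by (simp add: zero_less_mult_iff)
qed

lemma sum_mass: "(\<Sum>w\<in>words n. mass w) = 1"
  using mass_sum_right[of "[]" n] prob_space.prob_space[OF prob] by (simp add: mass_def)

text \<open>The weight is exactly multiplicative along an orbit; comparing mass with weight once for
  each of \<open>u @ v\<close>, \<open>u\<close> and \<open>v\<close> gives
  \<open>K ^ 3\<close>.\<close>

lemma mass_submultiplicative: "mass (u @ v) \<le> K ^ 3 * mass u * mass v"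
proof (cases "\<exists>x\<in>Z. window x (length (u @ v)) = u @ v")
  case True
  then obtain x where x: "x \<in> Z" "window x (length u) = u"
      "window ((shift ^^ length u) x) (length v) = v" "window x (length u + length v) = u @ v"
    by (auto simp: window_append_iff)
  have "mass (u @ v) \<le> K * (weight f P x (length u) * weight f P ((shift ^^ length u) x) (length v))"
    using mass_upper[OF x(1), of "length u + length v"] by (simp add: x(4) weight_add)
  also have "\<dots> \<le> K * ((K * mass u) * (K * mass v))"
    using mass_lower[OF x(1), of "length u"] mass_lower[OF shift_funpow_mem[OF x(1)], of "length u" "length v"] K_ge_1
    by (intro mult_left_mono mult_mono) (auto simp: x)
  finally show ?thesis by (simp add: power3_eq_cube ac_simps)
next
  case False
  then show ?thesis using mass_not_realized K_ge_1 by simp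
qed

text \<open>A glued point realises \<open>u @ c @ v\<close> for one filler \<open>c\<close>. The gap
  accounts for the exponential, three comparisons of mass with weight for \<open>K ^ 3\<close>. This
  is the near independence behind ergodicity.\<close>

lemma mass_gluing:
  assumes M: "\<And>z. z \<in> Z \<Longrightarrow> \<bar>f z\<bar> \<le> M"
  shows "exp (- real N * (M + \<bar>P\<bar>)) / K ^ 3 * mass u * mass v \<le> (\<Sum>c\<in>words N. mass (u @ c @ v))"
proof (cases "(\<exists>x\<in>Z. window x (length u) = u) \<and> (\<exists>y\<in>Z. window y (length v) = v)")
  case True
  then obtain x y where xy: "x \<in> Z" "window x (length u) = u" "y \<in> Z" "window y (length v) = v"
    by blast
  from glue_window[OF xy(1,3), of "length u"] obtain t where t: "t \<in> Z" "window t (length u) = u"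
    "window ((shift ^^ (length u + N)) t) (length v) = v"
    using xy by metis
  let ?n = "length u" and ?m = "length v"
  let ?t = "(shift ^^ ?n) t"
  define c where "c = window ?t N"
  have t': "window ((shift ^^ N) ?t) ?m = v"
    using t(3) by (simp add: funpow_shift algebra_simps)
  have ucv: "window t (?n + (N + ?m)) = u @ c @ v"
    using t t' by (simp add: window_add c_def)
  have "exp (- real N * (M + \<bar>P\<bar>)) * ((mass u / K) * (mass v / K)) \<le>
      weight f P ?t N * (weight f P t ?n * weight f P ((shift ^^ N) ?t) ?m)"
  proof (intro mult_mono)
    show "exp (- real N * (M + \<bar>P\<bar>)) \<le> weight f P ?t N"
      using t(1) M by (intro weight_ge) simp
    show "mass u / K \<le> weight f P t ?n"
      using mass_upper[OF t(1), of ?n] K_ge_1 t(2) by (simp add: field_simps)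
    show "mass v / K \<le> weight f P ((shift ^^ N) ?t) ?m"
      using mass_upper[of "(shift ^^ N) ?t" ?m] K_ge_1 t t' by (simp add: field_simps)
  qed (use K_ge_1 in auto)
  also have "\<dots> = weight f P t (?n + (N + ?m))" by (simp add: weight_add)
  also have "\<dots> \<le> K * mass (u @ c @ v)" using mass_lower[OF t(1)] ucv by metis
  finally have "exp (- real N * (M + \<bar>P\<bar>)) / K ^ 3 * mass u * mass v \<le> mass (u @ c @ v)"
    using K_ge_1 by (simp add: field_simps power3_eq_cube)
  also have "\<dots> \<le> (\<Sum>c\<in>words N. mass (u @ c @ v))"
    by (rule member_le_sum) (auto simp: c_def)
  finally show ?thesis .
next
  case False
  then have "mass u = 0 \<or> mass v = 0" using mass_not_realized by blast
  then show ?thesis by (auto intro!: sum_nonneg)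
qed

text \<open>The Gibbs constant \<open>K\<close> is not uniform over a regular family; this bound replaces it by a
  constant depending only on the potential, its pressure and the gluing gap.\<close>

lemma mass_le_uniform:
  assumes M: "\<And>z. z \<in> Z \<Longrightarrow> \<bar>f z\<bar> \<le> M"
    and D: "\<And>x y n. x \<in> Z \<Longrightarrow> y \<in> Z \<Longrightarrow> window x n = window y n \<Longrightarrow> \<bar>birkhoff f x n - birkhoff f y n\<bar> \<le> D"
    and x: "x \<in> Z"
  shows "mass (window x n) \<le> (exp 1 - 1) * exp (8 * D + real N * (M + \<bar>P\<bar>)) * weight f P x n"
proof -
  define realized where "realized w \<longleftrightarrow> (\<exists>x\<in>Z. window x (length w) = w)" for w
  define rep where "rep w = (SOME x. x \<in> Z \<and> window x (length w) = w)" for w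
  \<comment> \<open>The weight has to depend on the word alone: a realising point is chosen, and by
    bounded distortion the choice matters only up to a factor \<open>exp D\<close>.\<close>
  define G where "G w = (if realized w then weight f P (rep w) (length w) else 0)" for w
  have rep: "rep w \<in> Z" "window (rep w) (length w) = w" if "realized w" for w
    using that someI_ex[of "\<lambda>x. x \<in> Z \<and> window x (length w) = w"] unfolding realized_def rep_def by blast+
  have realizedI: "realized (window x n)" if "x \<in> Z" for x n
    unfolding realized_def using that by (intro bexI[of _ x]) auto
  have G0: "G w \<ge> 0" for w by (simp add: G_def)
  have near: "weight f P x n \<le> exp D * weight f P y n"
    if "x \<in> Z" "y \<in> Z" "window x n = window y n" for x y n
    using D[OF that] by (simp add: weight_def flip: exp_add)
  have G_ge: "weight f P x n \<le> exp D * G (window x n)" if "x \<in> Z" for x n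
    using near[of x "rep (window x n)" n] rep[OF realizedI[OF that]] realizedI[OF that] that by (simp add: G_def)
  have G_le: "G (window x n) \<le> exp D * weight f P x n" if "x \<in> Z" for x n
    using near[of "rep (window x n)" x n] rep[OF realizedI[OF that]] realizedI[OF that] that by (simp add: G_def)
  have exp2D: "exp (2 * D) = exp D * exp D" by (simp flip: exp_add)
  have G_sub: "G (u @ v) \<le> exp (2 * D) * G u * G v" for u v
  proof (cases "realized (u @ v)")
    case True
    obtain x where x_def: "x = rep (u @ v)" by simp
    have "x \<in> Z" and win: "window x (length u + length v) = u @ v"
      using rep[OF True] by (simp_all only: x_def length_append)
    from win have wins: "window x (length u) = u" "window ((shift ^^ length u) x) (length v) = v"
      unfolding window_append_iff by blast+
    have "G (u @ v) = weight f P x (length u) * weight f P ((shift ^^ length u) x) (length v)"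
      using True by (simp only: G_def x_def weight_add length_append if_True)
    also have "\<dots> \<le> (exp D * G u) * (exp D * G v)"
    proof (rule mult_mono)
      show "weight f P x (length u) \<le> exp D * G u"
        using G_ge[OF \<open>x \<in> Z\<close>, of "length u"] by (simp only: wins)
      show "weight f P ((shift ^^ length u) x) (length v) \<le> exp D * G v"
        using G_ge[OF shift_funpow_mem[OF \<open>x \<in> Z\<close>], of "length u" "length v"] by (simp only: wins)
    qed (simp_all add: G0)
    also have "\<dots> = exp (2 * D) * G u * G v"
      unfolding exp2D by (simp only: ac_simps)
    finally show ?thesis .
  next
    case False
    then have "G (u @ v) = 0" by (simp only: G_def if_False)
    then show ?thesis using G0 by simp
  qed
  \<comment> \<open>One \<open>D\<close> for each change of representative, at \<open>u\<close>, at
    \<open>v\<close> and at the glued word; the rest pays for the gap.\<close>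
  define b where "b = exp (- (3 * D + real N * (M + \<bar>P\<bar>)))"
  have G_super: "b * G u * G v \<le> (\<Sum>c\<in>words N. G (u @ c @ v))" for u v
  proof (cases "realized u \<and> realized v")
    case True
    let ?n = "length u" and ?m = "length v"
    from glue_window[OF rep(1) rep(1), of u v ?n] obtain t where
      t: "t \<in> Z" "window t ?n = u" "window ((shift ^^ (?n + N)) t) ?m = v"
      using True rep by metis
    let ?t = "(shift ^^ ?n) t"
    define c where "c = window ?t N"
    have t': "window ((shift ^^ N) ?t) ?m = v"
      using t(3) by (simp add: funpow_shift algebra_simps)
    have ucv: "window t (?n + (N + ?m)) = u @ c @ v"
      using t t' by (simp add: window_add c_def)
    have "exp (- real N * (M + \<bar>P\<bar>)) * (exp (- D) * G u * (exp (- D) * G v)) \<le>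
        weight f P ?t N * (weight f P t ?n * weight f P ((shift ^^ N) ?t) ?m)"
    proof (intro mult_mono)
      show "exp (- real N * (M + \<bar>P\<bar>)) \<le> weight f P ?t N"
        using t(1) M by (intro weight_ge) simp
      show "exp (- D) * G u \<le> weight f P t ?n"
        using G_le[OF t(1), of ?n] t(2) by (simp add: exp_minus field_simps)
      show "exp (- D) * G v \<le> weight f P ((shift ^^ N) ?t) ?m"
        using G_le[of "(shift ^^ N) ?t" ?m] t t' by (simp add: exp_minus field_simps)
    qed (use G0 in auto)
    also have "\<dots> = weight f P t (?n + (N + ?m))" by (simp add: weight_add)
    also have "\<dots> \<le> exp D * G (u @ c @ v)" using G_ge[OF t(1)] ucv by metis
    finally have "exp (- D) * (exp (- real N * (M + \<bar>P\<bar>)) * (exp (- D) * G u * (exp (- D) * G v)))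
        \<le> exp (- D) * (exp D * G (u @ c @ v))"
      by (rule mult_left_mono) simp
    also have "exp (- D) * (exp D * G (u @ c @ v)) = G (u @ c @ v)"
      by (simp add: exp_minus)
    also have "exp (- D) * (exp (- real N * (M + \<bar>P\<bar>)) * (exp (- D) * G u * (exp (- D) * G v))) = b * G u * G v"
    proof -
      have "b = exp (- D) * exp (- D) * exp (- D) * exp (- real N * (M + \<bar>P\<bar>))"
        by (simp add: b_def flip: exp_add)
      then show ?thesis by (simp add: ac_simps)
    qed
    also have "G (u @ c @ v) \<le> (\<Sum>c\<in>words N. G (u @ c @ v))"
      by (rule member_le_sum) (auto simp: c_def G0)
    finally show ?thesis .
  next
    case False
    then have "G u = 0 \<or> G v = 0" by (auto simp: G_def)
    then show ?thesis by (auto intro!: sum_nonneg G0)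
  qed
  have "G w \<le> K * mass w" for w
  proof (cases "realized w")
    case True
    then show ?thesis using mass_lower[OF rep(1)[OF True], of "length w"] rep[OF True]
      by (simp add: G_def)
  qed (use K_ge_1 in \<open>simp add: G_def\<close>)
  then have "sum G (words n) \<le> K * (\<Sum>w\<in>words n. mass w)" for n
    unfolding sum_distrib_left by (intro sum_mono)
  then have bdd: "sum G (words n) \<le> K" for n by (simp add: sum_mass)
  have sum_le: "sum G (words n) \<le> 1 / b" for n
    by (rule sum_words_le_of_supermultiplicative[OF G0 _ G_super bdd]) (simp add: b_def)
  have mass_G: "mass w \<le> K * G w" for w
  proof (cases "realized w")
    case True
    then show ?thesis using mass_upper[OF rep(1)[OF True], of "length w"] rep[OF True]
      by (simp add: G_def)
  next
    case False
    then have "mass w = 0" using mass_not_realized by (simp add: realized_def)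
    then show ?thesis using G0 K_ge_1 by simp
  qed
  have "mass (window x n) \<le> (exp 1 - 1) * (exp (2 * D))\<^sup>2 * (1 / b) * G (window x n)"
    using sum_mass[of 0]
    by (intro stationary_le_weight[OF G0 G_sub sum_le _ _ _ mass_sum_right mass_sum_left mass_G])
      (auto simp: words_def)
  also have "\<dots> \<le> (exp 1 - 1) * (exp (2 * D))\<^sup>2 * (1 / b) * (exp D * weight f P x n)"
    using G_le[OF x, of n] by (intro mult_left_mono) (auto simp: b_def)
  also have "\<dots> = (exp 1 - 1) * ((exp (2 * D))\<^sup>2 * (1 / b) * exp D) * weight f P x n"
    by (simp add: ac_simps)
  \<comment> \<open>Origin of \<open>8 * D\<close>: twice \<open>2 * D\<close> from the two cuts
    around the word, \<open>3 * D\<close> from the gluing bound, and \<open>D\<close> from the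
    return to the point \<open>x\<close>.\<close>
  also have "(exp (2 * D))\<^sup>2 * (1 / b) * exp D = exp (2 * D + 2 * D + (3 * D + real N * (M + \<bar>P\<bar>)) + D)"
    unfolding b_def exp_minus exp_add power2_eq_square by (simp add: divide_simps)
  also have "2 * D + 2 * D + (3 * D + real N * (M + \<bar>P\<bar>)) + D = 8 * D + real N * (M + \<bar>P\<bar>)"
    by simp
  finally show ?thesis .
qed

end

section \<open>Comparison of two Gibbs measures\<close>

lemma weight_le_of_close:
  assumes "\<And>k. \<bar>f ((shift ^^ k) x) - g ((shift ^^ k) x)\<bar> \<le> \<eta>"
  shows "weight f P x n \<le> exp (real n * (\<eta> + Q - P)) * weight g Q x n"
proof -
  have "birkhoff f x n - birkhoff g x n \<le> real n * \<eta>"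
    using abs_birkhoff_le[of "\<lambda>x. f x - g x" x \<eta> n, OF assms] unfolding birkhoff_diff by linarith
  then have "birkhoff f x n - real n * P \<le> real n * (\<eta> + Q - P) + (birkhoff g x n - real n * Q)"
    by (simp add: algebra_simps)
  then show ?thesis
    unfolding weight_def exp_add[symmetric] by simp
qed

text \<open>Both measures distribute mass 1 over the words of each length, whereas
  \<open>P > Q + \<eta>\<close> would make all masses for \<open>f\<close> exponentially smaller
  than those for \<open>g\<close>. Used in both directions, this makes the pressure 1-Lipschitz in
  the sup norm.\<close>

lemma pressure_le:
  assumes f: "gibbs_state Z N \<mu> f K P" and g: "gibbs_state Z N \<nu> g L Q"
    and close: "\<And>z. z \<in> Z \<Longrightarrow> \<bar>f z - g z\<bar> \<le> \<eta>"
  shows "P \<le> Q + \<eta>"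
proof (rule ccontr)
  interpret f: gibbs_state Z N \<mu> f K P by fact
  interpret g: gibbs_state Z N \<nu> g L Q by fact
  define s where "s = exp (\<eta> + Q - P)"
  assume "\<not> ?thesis"
  then have s: "0 < s" "s < 1" by (auto simp: s_def)
  have "1 \<le> K * L * s ^ n" for n
  proof -
    have "f.mass w \<le> K * L * s ^ n * g.mass w" if w: "length w = n" for w
    proof (cases "\<exists>x\<in>Z. window x (length w) = w")
      case True
      then obtain x where x: "x \<in> Z" "window x n = w" using w by auto
      have "f.mass w \<le> K * weight f P x n"
        using f.mass_upper[OF x(1), of n] x by simp
      also have "\<dots> \<le> K * (s ^ n * weight g Q x n)"
        using weight_le_of_close[of f x g \<eta> P n Q] close x f.K_ge_1
        by (intro mult_left_mono) (auto simp: s_def exp_of_nat_mult)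
      also have "\<dots> \<le> K * (s ^ n * (L * g.mass w))"
        using g.mass_lower[OF x(1), of n] x f.K_ge_1 s by (intro mult_left_mono) auto
      finally show ?thesis by (simp add: ac_simps)
    next
      case False
      then show ?thesis using f.mass_not_realized s f.K_ge_1 g.K_ge_1 by simp
    qed
    then have "(\<Sum>w\<in>words n. f.mass w) \<le> (\<Sum>w\<in>words n. K * L * s ^ n * g.mass w)"
      by (intro sum_mono) auto
    then show ?thesis by (simp add: f.sum_mass g.sum_mass flip: sum_distrib_left)
  qed
  moreover have "(\<lambda>n. K * L * s ^ n) \<longlonglongrightarrow> K * L * 0"
    using s by (intro tendsto_intros LIMSEQ_realpow_zero) auto
  ultimately have "1 \<le> K * L * 0"
    by (intro LIMSEQ_le_const) auto
  then show False by simp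
qed

lemma gibbs_ratio_decay:
  assumes p: "gibbs_state Z N p f K P" and q: "gibbs_state Z N q g L Q" and "p \<noteq> q"
    and f: "\<And>z. z \<in> Z \<Longrightarrow> \<bar>f z\<bar> \<le> M" and g: "\<And>z. z \<in> Z \<Longrightarrow> \<bar>g z\<bar> \<le> M'"
  obtains \<rho> where "0 < \<rho>" "\<rho> < 1"
    "AE y in p. eventually (\<lambda>n. measure q (cyl Z y n) \<le> \<rho> ^ n * measure p (cyl Z y n)) sequentially"
proof -
  interpret p: gibbs_state Z N p f K P by fact
  interpret q: gibbs_state Z N q g L Q by fact
  have erg_p: "measure p A = 0 \<or> measure p A = 1"
    if "A \<in> sets p" "measure p (sym_diff (shift -` A) A) = 0" for A
    using p.K_ge_1 by (intro p.ergodic_of_gluing[OF p.prob _ p.mass_gluing[OF f] that]) auto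
  have erg_q: "measure q A = 0 \<or> measure q A = 1"
    if "A \<in> sets q" "measure q (sym_diff (shift -` A) A) = 0" for A
    using q.K_ge_1 by (intro q.ergodic_of_gluing[OF q.prob _ q.mass_gluing[OF g] that]) auto
  obtain A where A: "A \<in> sets p" "measure p A = 1" "measure q A = 0"
    using ex_singular_set[OF p.invariant_measure_axioms p.prob q.invariant_measure_axioms q.prob
      erg_p erg_q \<open>p \<noteq> q\<close>] by blast
  define h where "h w = sqrt (p.mass w * q.mass w)" for w
  define B where "B = sqrt (K ^ 3 * L ^ 3)"
  have "1 \<le> K ^ 3" "1 \<le> L ^ 3"
    using p.K_ge_1 q.K_ge_1 by simp_all
  then have "1 * 1 \<le> K ^ 3 * L ^ 3" using p.K_ge_1 by (intro mult_mono) auto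
  then have B: "B \<ge> 1" by (simp add: B_def)
  then have "1 / B > 0" by simp
  from ex_affinity_less[OF p.invariant_measure_axioms p.prob q.invariant_measure_axioms q.prob A this]
  obtain n0 where n0: "sum h (words n0) < 1 / B" unfolding h_def by blast
  have sub: "h (u @ v) \<le> B * h u * h v" for u v
  proof -
    have "p.mass (u @ v) * q.mass (u @ v) \<le> (K ^ 3 * p.mass u * p.mass v) * (L ^ 3 * q.mass u * q.mass v)"
      using p.K_ge_1 by (intro mult_mono p.mass_submultiplicative q.mass_submultiplicative) auto
    then have "h (u @ v) \<le> sqrt ((K ^ 3 * L ^ 3) * (p.mass u * q.mass u) * (p.mass v * q.mass v))"
      unfolding h_def by (intro real_sqrt_le_mono) (simp add: ac_simps)
    then show ?thesis by (simp add: B_def h_def real_sqrt_mult)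
  qed
  have le1: "sum h (words n) \<le> 1" for n
    using sum_sqrt_le[of p.mass q.mass "words n"] by (simp add: h_def p.sum_mass q.sum_mass)
  \<comment> \<open>At length 0 the affinity is 1, which is not below \<open>1 / B\<close> because
    \<open>B \<ge> 1\<close>.\<close>
  have "n0 \<noteq> 0"
  proof
    assume "n0 = 0"
    with n0 p.sum_mass[of 0] q.sum_mass[of 0] B show False by (simp add: words_def h_def)
  qed
  then have n0_pos: "n0 > 0" by simp
  have lt1: "B * sum h (words n0) < 1" using n0 B by (simp add: field_simps)
  have h0: "h u \<ge> 0" for u by (simp add: h_def)
  have "B \<ge> 0" using B by simp
  from submultiplicative_sum_decay[OF h0 sub this le1 n0_pos lt1] obtain C \<rho> where \<rho>: "0 < \<rho>" "\<rho> < 1" "\<And>n. sum h (words n) \<le> C * \<rho> ^ n"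
    by blast
  from AE_mass_ratio_le[OF p.invariant_measure_axioms q.invariant_measure_axioms \<rho>(1,2), of C] \<rho>(3)
  have "AE y in p. eventually (\<lambda>n. q.mass (window y n) \<le> \<rho> ^ n * p.mass (window y n)) sequentially"
    by (simp add: h_def)
  with \<rho>(1,2) show thesis by (intro that) (simp_all add: p.cyl_eq_mass q.cyl_eq_mass)
qed

subsection \<open>Regular families of potentials\<close>

lemma seq_dist_pos: "x \<noteq> y \<Longrightarrow> seq_dist x y > 0"
  by (simp add: seq_dist_def)

lemma holder_iff:
  "holder Z r f \<longleftrightarrow> (\<exists>M\<ge>0. (\<forall>x\<in>Z. \<bar>f x\<bar> \<le> M) \<and>
     (\<forall>x\<in>Z. \<forall>y\<in>Z. \<bar>f x - f y\<bar> \<le> M * seq_dist x y powr r))"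
proof
  assume "holder Z r f"
  then obtain A B where A': "\<forall>x\<in>Z. \<bar>f x\<bar> \<le> A"
    and B': "\<forall>x y. x \<in> Z \<and> y \<in> Z \<and> x \<noteq> y \<longrightarrow> \<bar>f x - f y\<bar> / seq_dist x y powr r \<le> B"
    unfolding holder_def bdd_above_def by auto
  have A: "\<bar>f x\<bar> \<le> A" if "x \<in> Z" for x using A' that by blast
  have B: "\<bar>f x - f y\<bar> / seq_dist x y powr r \<le> B" if "x \<in> Z" "y \<in> Z" "x \<noteq> y" for x y
    using B' that by blast
  define M where "M = max 0 (max A B)"
  have "\<bar>f x - f y\<bar> \<le> M * seq_dist x y powr r" if "x \<in> Z" "y \<in> Z" for x y
  proof (cases "x = y")
    case False
    then have "\<bar>f x - f y\<bar> \<le> B * seq_dist x y powr r"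
      using B[OF that False] seq_dist_pos[OF False] by (simp add: field_simps)
    also have "\<dots> \<le> M * seq_dist x y powr r"
      by (intro mult_right_mono) (auto simp: M_def)
    finally show ?thesis .
  qed (simp add: M_def)
  moreover have "\<bar>f x\<bar> \<le> M" if "x \<in> Z" for x
    using A[OF that] by (simp add: M_def)
  ultimately show "\<exists>M\<ge>0. (\<forall>x\<in>Z. \<bar>f x\<bar> \<le> M) \<and>
     (\<forall>x\<in>Z. \<forall>y\<in>Z. \<bar>f x - f y\<bar> \<le> M * seq_dist x y powr r)"
    by (intro exI[of _ M]) (auto simp: M_def)
next
  assume "\<exists>M\<ge>0. (\<forall>x\<in>Z. \<bar>f x\<bar> \<le> M) \<and>
     (\<forall>x\<in>Z. \<forall>y\<in>Z. \<bar>f x - f y\<bar> \<le> M * seq_dist x y powr r)"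
  then obtain M where M: "\<And>x. x \<in> Z \<Longrightarrow> \<bar>f x\<bar> \<le> M"
    "\<And>x y. x \<in> Z \<Longrightarrow> y \<in> Z \<Longrightarrow> \<bar>f x - f y\<bar> \<le> M * seq_dist x y powr r" by blast
  have "\<bar>f x - f y\<bar> / seq_dist x y powr r \<le> M" if "x \<in> Z" "y \<in> Z" "x \<noteq> y" for x y
    using M(2)[OF that(1,2)] seq_dist_pos[OF that(3)] by (simp add: field_simps)
  with M(1) show "holder Z r f"
    unfolding holder_def by (intro conjI bdd_aboveI[of _ M]) auto
qed

lemma holder_diff:
  assumes "holder Z r f" "holder Z r g"
  shows "holder Z r (\<lambda>x. f x - g x)"
proof -
  from assms obtain A B where "A \<ge> 0" "B \<ge> 0"
    and A: "\<And>x. x \<in> Z \<Longrightarrow> \<bar>f x\<bar> \<le> A" "\<And>x y. x \<in> Z \<Longrightarrow> y \<in> Z \<Longrightarrow> \<bar>f x - f y\<bar> \<le> A * seq_dist x y powr r"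
    and B: "\<And>x. x \<in> Z \<Longrightarrow> \<bar>g x\<bar> \<le> B" "\<And>x y. x \<in> Z \<Longrightarrow> y \<in> Z \<Longrightarrow> \<bar>g x - g y\<bar> \<le> B * seq_dist x y powr r"
    unfolding holder_iff by metis
  have "\<bar>f x - g x\<bar> \<le> A + B" if "x \<in> Z" for x
    using A(1)[OF that] B(1)[OF that] by linarith
  moreover have "\<bar>(f x - g x) - (f y - g y)\<bar> \<le> (A + B) * seq_dist x y powr r" if "x \<in> Z" "y \<in> Z" for x y
    using A(2)[OF that] B(2)[OF that] unfolding distrib_right by linarith
  ultimately show ?thesis
    unfolding holder_iff using \<open>A \<ge> 0\<close> \<open>B \<ge> 0\<close> by (intro exI[of _ "A + B"]) auto
qed

text \<open>Two distinct points ensure that both suprema in the norm range over non-empty sets and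
  are non-negative, so that each is bounded by their sum. On a one-point space the second supremum
  is over the empty set and has no usable value.\<close>

lemma holder_norm_bounds:
  assumes h: "holder Z r h" and le: "holder_norm Z r h \<le> e"
    and two: "a \<in> Z" "b \<in> Z" "a \<noteq> b"
  shows "x \<in> Z \<Longrightarrow> \<bar>h x\<bar> \<le> e"
    and "x \<in> Z \<Longrightarrow> y \<in> Z \<Longrightarrow> \<bar>h x - h y\<bar> \<le> e * seq_dist x y powr r"
proof -
  define A where "A = (SUP x\<in>Z. \<bar>h x\<bar>)"
  define B where "B = (SUP (x,y)\<in>{(x,y). x \<in> Z \<and> y \<in> Z \<and> x \<noteq> y}. \<bar>h x - h y\<bar> / seq_dist x y powr r)"
  have A: "\<bar>h x\<bar> \<le> A" if "x \<in> Z" for x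
    unfolding A_def using h that by (intro cSUP_upper) (auto simp: holder_def)
  have B: "\<bar>h x - h y\<bar> / seq_dist x y powr r \<le> B" if "x \<in> Z" "y \<in> Z" "x \<noteq> y" for x y
  proof -
    have "(\<lambda>(x, y). \<bar>h x - h y\<bar> / seq_dist x y powr r) (x, y) \<le> B"
      unfolding B_def using h that by (intro cSUP_upper) (auto simp: holder_def)
    then show ?thesis by simp
  qed
  have "A \<ge> 0" using A[OF two(1)] by linarith
  have "0 \<le> \<bar>h a - h b\<bar> / seq_dist a b powr r" by simp
  with B[OF two] have "B \<ge> 0" by linarith
  have AB: "A + B \<le> e" using le by (simp add: holder_norm_def A_def B_def)
  show "x \<in> Z \<Longrightarrow> \<bar>h x\<bar> \<le> e" using A[of x] AB \<open>B \<ge> 0\<close> by linarith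
  assume xy: "x \<in> Z" "y \<in> Z"
  show "\<bar>h x - h y\<bar> \<le> e * seq_dist x y powr r"
  proof (cases "x = y")
    case False
    then have "\<bar>h x - h y\<bar> \<le> B * seq_dist x y powr r"
      using B[OF xy False] seq_dist_pos[OF False] by (simp add: field_simps)
    also have "\<dots> \<le> e * seq_dist x y powr r"
      using AB \<open>A \<ge> 0\<close> by (intro mult_right_mono) auto
    finally show ?thesis .
  qed (simp add: seq_dist_def)
qed

locale gibbs_family = glued_shift Z N
  for Z :: "(int \<Rightarrow> 'a::finite) set" and N +
  fixes \<Theta> :: "'b::metric_space set" and f :: "'b \<Rightarrow> (int \<Rightarrow> 'a) \<Rightarrow> real"
    and \<mu> :: "'b \<Rightarrow> (int \<Rightarrow> 'a) measure"
  assumes regular: "regular_family Z \<Theta> f"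
    and gibbs: "\<And>\<theta>. \<theta> \<in> \<Theta> \<Longrightarrow> gibbs_measure Z (f \<theta>) (\<mu> \<theta>)"
    and two_points: "\<exists>a\<in>Z. \<exists>b\<in>Z. a \<noteq> b"
begin

lemma ex_state:
  assumes "\<theta> \<in> \<Theta>"
  obtains K P where "gibbs_state Z N (\<mu> \<theta>) (f \<theta>) K P"
  using gibbs_measure_state[OF glued_shift_axioms gibbs[OF assms]] .

text \<open>\<open>M\<close> and \<open>D\<close> are fixed before \<open>\<eta>\<close>, so that
  shrinking the neighbourhood does not affect the constants of the uniform upper bound. Staying
  within Hoelder distance 1 of the centre adds at most 1 to its Hoelder constants.\<close>

lemma local_bounds:
  assumes "\<theta>\<^sub>1 \<in> \<Theta>"
  obtains M D where
    "\<And>\<eta>. \<eta> > 0 \<Longrightarrow> \<exists>\<delta>>0. \<forall>\<theta>\<in>\<Theta>. dist \<theta> \<theta>\<^sub>1 < \<delta> \<longrightarrow>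
      (\<forall>x\<in>Z. \<bar>f \<theta> x - f \<theta>\<^sub>1 x\<bar> \<le> \<eta>) \<and> (\<forall>x\<in>Z. \<bar>f \<theta> x\<bar> \<le> M) \<and>
      (\<forall>x\<in>Z. \<forall>y\<in>Z. \<forall>n. window x n = window y n \<longrightarrow> \<bar>birkhoff (f \<theta>) x n - birkhoff (f \<theta>) y n\<bar> \<le> D)"
proof -
  from regular obtain r where "r > 0" and hol: "\<And>\<theta>. \<theta> \<in> \<Theta> \<Longrightarrow> holder Z r (f \<theta>)"
    and cont: "\<And>\<theta>0 e. \<theta>0 \<in> \<Theta> \<Longrightarrow> e > 0 \<Longrightarrow> \<exists>\<delta>>0. \<forall>\<theta>\<in>\<Theta>. dist \<theta> \<theta>0 < \<delta> \<longrightarrow>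
        holder_norm Z r (\<lambda>x. f \<theta> x - f \<theta>0 x) < e"
    unfolding regular_family_def by blast
  from two_points obtain a b where ab: "a \<in> Z" "b \<in> Z" "a \<noteq> b" by blast
  from hol[OF assms] obtain A where "A \<ge> 0" and A: "\<And>x. x \<in> Z \<Longrightarrow> \<bar>f \<theta>\<^sub>1 x\<bar> \<le> A"
    "\<And>x y. x \<in> Z \<Longrightarrow> y \<in> Z \<Longrightarrow> \<bar>f \<theta>\<^sub>1 x - f \<theta>\<^sub>1 y\<bar> \<le> A * seq_dist x y powr r"
    unfolding holder_iff by blast
  show thesis
  proof (rule that[of "A + 1" "distortion_const (A + 1) r"])
    fix \<eta> :: real assume "\<eta> > 0"
    then obtain \<delta> where \<delta>: "\<delta> > 0" "\<And>\<theta>. \<theta> \<in> \<Theta> \<Longrightarrow> dist \<theta> \<theta>\<^sub>1 < \<delta> \<Longrightarrow>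
        holder_norm Z r (\<lambda>x. f \<theta> x - f \<theta>\<^sub>1 x) < min \<eta> 1"
      using cont[OF assms, of "min \<eta> 1"] by auto
    have "(\<forall>x\<in>Z. \<bar>f \<theta> x - f \<theta>\<^sub>1 x\<bar> \<le> \<eta>) \<and> (\<forall>x\<in>Z. \<bar>f \<theta> x\<bar> \<le> A + 1) \<and>
      (\<forall>x\<in>Z. \<forall>y\<in>Z. \<forall>n. window x n = window y n \<longrightarrow>
        \<bar>birkhoff (f \<theta>) x n - birkhoff (f \<theta>) y n\<bar> \<le> distortion_const (A + 1) r)"
      if \<theta>: "\<theta> \<in> \<Theta>" "dist \<theta> \<theta>\<^sub>1 < \<delta>" for \<theta>
    proof -
      let ?h = "\<lambda>x. f \<theta> x - f \<theta>\<^sub>1 x"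
      have h: "holder Z r ?h" using hol \<theta>(1) assms by (intro holder_diff)
      have nrm: "holder_norm Z r ?h \<le> min \<eta> 1" using \<delta>(2)[OF \<theta>] by simp
      note near = holder_norm_bounds(1)[OF h nrm ab]
      have near_hol: "\<bar>?h x - ?h y\<bar> \<le> 1 * seq_dist x y powr r" if "x \<in> Z" "y \<in> Z" for x y
        using holder_norm_bounds(2)[OF h _ ab that, of 1] nrm by simp
      have bdd: "\<bar>f \<theta> x\<bar> \<le> A + 1" if "x \<in> Z" for x
        using near[OF that] A(1)[OF that] by linarith
      have hol': "\<bar>f \<theta> x - f \<theta> y\<bar> \<le> (A + 1) * seq_dist x y powr r" if "x \<in> Z" "y \<in> Z" for x y
        using near_hol[OF that] A(2)[OF that] unfolding distrib_right by linarith
      have "\<bar>birkhoff (f \<theta>) x n - birkhoff (f \<theta>) y n\<bar> \<le> distortion_const (A + 1) r"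
        if "x \<in> Z" "y \<in> Z" "window x n = window y n" for x y n
        using that \<open>A \<ge> 0\<close> by (intro birkhoff_distortion[OF _ \<open>r > 0\<close> _ hol']) (auto simp: shift_mem_iff)
      with near bdd show ?thesis by (meson min.bounded_iff)
    qed
    with \<open>\<delta> > 0\<close> show "\<exists>\<delta>>0. \<forall>\<theta>\<in>\<Theta>. dist \<theta> \<theta>\<^sub>1 < \<delta> \<longrightarrow>
      (\<forall>x\<in>Z. \<bar>f \<theta> x - f \<theta>\<^sub>1 x\<bar> \<le> \<eta>) \<and> (\<forall>x\<in>Z. \<bar>f \<theta> x\<bar> \<le> A + 1) \<and>
      (\<forall>x\<in>Z. \<forall>y\<in>Z. \<forall>n. window x n = window y n \<longrightarrow>
        \<bar>birkhoff (f \<theta>) x n - birkhoff (f \<theta>) y n\<bar> \<le> distortion_const (A + 1) r)"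
      by blast
  qed
qed

text \<open>Each symbol loses at most \<open>\<eta>\<close> through the potential and another
  \<open>\<eta>\<close> through the pressure.\<close>

lemma weight_comparison:
  assumes p: "gibbs_state Z N p g K P" and q: "gibbs_state Z N q h L Q"
    and close: "\<And>z. z \<in> Z \<Longrightarrow> \<bar>g z - h z\<bar> \<le> \<eta>" and x: "x \<in> Z"
  shows "weight g P x n \<le> exp (2 * \<eta>) ^ n * weight h Q x n"
proof -
  have "Q \<le> P + \<eta>"
    using pressure_le[OF q p, of \<eta>] close by (simp add: abs_minus_commute)
  have "weight g P x n \<le> exp (real n * (\<eta> + Q - P)) * weight h Q x n"
    using x close by (intro weight_le_of_close) simp
  also have "\<dots> \<le> exp (real n * (2 * \<eta>)) * weight h Q x n"
    using \<open>Q \<le> P + \<eta>\<close> by (intro mult_right_mono) (auto intro!: mult_left_mono)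
  finally show ?thesis by (simp add: exp_of_nat_mult)
qed

lemma local_ratio_decay:
  assumes \<theta>s: "\<theta>s \<in> \<Theta>" and \<theta>1: "\<theta>\<^sub>1 \<in> \<Theta>" and neq: "\<mu> \<theta>\<^sub>1 \<noteq> \<mu> \<theta>s"
  obtains \<delta> \<rho> where "\<delta> > 0" "0 < \<rho>" "\<rho> < 1"
    "AE y in \<mu> \<theta>s. eventually (\<lambda>n. \<forall>\<theta>\<in>\<Theta>. dist \<theta> \<theta>\<^sub>1 < \<delta> \<longrightarrow>
        measure (\<mu> \<theta>) (cyl Z y n) \<le> \<rho> ^ n * measure (\<mu> \<theta>s) (cyl Z y n)) sequentially"
proof -
  obtain M D where MD: "\<And>\<eta>. \<eta> > 0 \<Longrightarrow> \<exists>\<delta>>0. \<forall>\<theta>\<in>\<Theta>. dist \<theta> \<theta>\<^sub>1 < \<delta> \<longrightarrow>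
      (\<forall>x\<in>Z. \<bar>f \<theta> x - f \<theta>\<^sub>1 x\<bar> \<le> \<eta>) \<and> (\<forall>x\<in>Z. \<bar>f \<theta> x\<bar> \<le> M) \<and>
      (\<forall>x\<in>Z. \<forall>y\<in>Z. \<forall>n. window x n = window y n \<longrightarrow> \<bar>birkhoff (f \<theta>) x n - birkhoff (f \<theta>) y n\<bar> \<le> D)"
    using local_bounds[OF \<theta>1] by blast
  have bdd1: "\<bar>f \<theta>\<^sub>1 z\<bar> \<le> M" if "z \<in> Z" for z
    using MD[of 1] \<theta>1 that by auto
  obtain M' where bdds: "\<And>z. z \<in> Z \<Longrightarrow> \<bar>f \<theta>s z\<bar> \<le> M'"
  proof (rule local_bounds[OF \<theta>s])
    fix M D
    assume "\<And>\<eta>. \<eta> > 0 \<Longrightarrow> \<exists>\<delta>>0. \<forall>\<theta>\<in>\<Theta>. dist \<theta> \<theta>s < \<delta> \<longrightarrow>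
      (\<forall>x\<in>Z. \<bar>f \<theta> x - f \<theta>s x\<bar> \<le> \<eta>) \<and> (\<forall>x\<in>Z. \<bar>f \<theta> x\<bar> \<le> M) \<and>
      (\<forall>x\<in>Z. \<forall>y\<in>Z. \<forall>n. window x n = window y n \<longrightarrow> \<bar>birkhoff (f \<theta>) x n - birkhoff (f \<theta>) y n\<bar> \<le> D)"
    from this[of 1] \<theta>s have "\<forall>z\<in>Z. \<bar>f \<theta>s z\<bar> \<le> M" by auto
    then show thesis using that by blast
  qed
  obtain K P where s: "gibbs_state Z N (\<mu> \<theta>s) (f \<theta>s) K P" using ex_state[OF \<theta>s] .
  obtain L Q where t: "gibbs_state Z N (\<mu> \<theta>\<^sub>1) (f \<theta>\<^sub>1) L Q" using ex_state[OF \<theta>1] .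
  interpret s: gibbs_state Z N "\<mu> \<theta>s" "f \<theta>s" K P by (rule s)
  interpret t: gibbs_state Z N "\<mu> \<theta>\<^sub>1" "f \<theta>\<^sub>1" L Q by (rule t)
  interpret prob_space "\<mu> \<theta>s" by (rule s.prob)
  obtain a where a: "0 < a" "a < 1" and AE_a: "AE y in \<mu> \<theta>s. eventually
      (\<lambda>n. measure (\<mu> \<theta>\<^sub>1) (cyl Z y n) \<le> a ^ n * measure (\<mu> \<theta>s) (cyl Z y n)) sequentially"
    using gibbs_ratio_decay[OF s t neq[symmetric] bdds bdd1] by blast
  \<comment> \<open>Makes \<open>exp (2 * \<eta>) * a = sqrt a\<close>: moving to a neighbour
    consumes half of the decay rate.\<close>
  define \<eta> where "\<eta> = - ln a / 4"
  have \<eta>: "\<eta> > 0" using a by (simp add: \<eta>_def)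
  define b where "b = exp (2 * \<eta>) * a"
  have "b = exp (2 * \<eta> + ln a)" using a by (simp add: b_def exp_add)
  then have b: "0 < b" "b < 1" using a by (simp_all add: \<eta>_def)
  \<comment> \<open>Strictly between \<open>b\<close> and 1, so as to absorb the constant
    \<open>C * L\<close> for large \<open>n\<close>.\<close>
  define \<rho> where "\<rho> = (b + 1) / 2"
  have \<rho>: "0 < \<rho>" "\<rho> < 1" "b < \<rho>" using b by (auto simp: \<rho>_def)
  \<comment> \<open>Pressures in the ball differ from \<open>Q\<close> by at most
    \<open>\<eta>\<close>, so \<open>\<bar>Q\<bar> + \<eta>\<close> serves for all parameters
    there.\<close>
  define C where "C = (exp 1 - 1) * exp (8 * D + real N * (M + (\<bar>Q\<bar> + \<eta>)))"
  have "C \<ge> 0" by (simp add: C_def)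
  obtain \<delta> where "\<delta> > 0" and \<delta>: "\<And>\<theta>. \<theta> \<in> \<Theta> \<Longrightarrow> dist \<theta> \<theta>\<^sub>1 < \<delta> \<Longrightarrow>
      (\<forall>x\<in>Z. \<bar>f \<theta> x - f \<theta>\<^sub>1 x\<bar> \<le> \<eta>) \<and> (\<forall>x\<in>Z. \<bar>f \<theta> x\<bar> \<le> M) \<and>
      (\<forall>x\<in>Z. \<forall>y\<in>Z. \<forall>n. window x n = window y n \<longrightarrow> \<bar>birkhoff (f \<theta>) x n - birkhoff (f \<theta>) y n\<bar> \<le> D)"
    using MD[OF \<eta>] by blast
  \<comment> \<open>Holds at every \<open>y\<close> in \<open>Z\<close>, so the null set of the
    centre serves the whole ball. The upper bound at \<open>\<theta>\<close> uses the uniform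
    constant, the lower bound is taken at the centre with its own \<open>L\<close>.\<close>
  have near: "measure (\<mu> \<theta>) (cyl Z y n) \<le> C * L * exp (2 * \<eta>) ^ n * measure (\<mu> \<theta>\<^sub>1) (cyl Z y n)"
    if \<theta>: "\<theta> \<in> \<Theta>" "dist \<theta> \<theta>\<^sub>1 < \<delta>" and y: "y \<in> Z" for \<theta> y n
  proof -
    obtain K' P' where u: "gibbs_state Z N (\<mu> \<theta>) (f \<theta>) K' P'" using ex_state[OF \<theta>(1)] .
    interpret u: gibbs_state Z N "\<mu> \<theta>" "f \<theta>" K' P' by (rule u)
    have close: "\<And>z. z \<in> Z \<Longrightarrow> \<bar>f \<theta> z - f \<theta>\<^sub>1 z\<bar> \<le> \<eta>" using \<delta>[OF \<theta>] by blast
    have "P' \<le> Q + \<eta>" using pressure_le[OF u t close] .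
    moreover have "Q \<le> P' + \<eta>" using pressure_le[OF t u, of \<eta>] close by (simp add: abs_minus_commute)
    ultimately have "\<bar>P'\<bar> \<le> \<bar>Q\<bar> + \<eta>" by linarith
    then have "(exp 1 - 1) * exp (8 * D + real N * (M + \<bar>P'\<bar>)) \<le> C"
      unfolding C_def by (intro mult_left_mono) (auto intro!: mult_left_mono)
    moreover have "u.mass (window y n) \<le> (exp 1 - 1) * exp (8 * D + real N * (M + \<bar>P'\<bar>)) * weight (f \<theta>) P' y n"
      using \<delta>[OF \<theta>] y by (intro u.mass_le_uniform) blast+
    ultimately have "u.mass (window y n) \<le> C * weight (f \<theta>) P' y n"
      by (meson mult_right_mono order_trans weight_nonneg)
    also have "\<dots> \<le> C * (exp (2 * \<eta>) ^ n * weight (f \<theta>\<^sub>1) Q y n)"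
      using \<open>C \<ge> 0\<close> by (intro mult_left_mono weight_comparison[OF u t close y])
    also have "\<dots> \<le> C * (exp (2 * \<eta>) ^ n * (L * t.mass (window y n)))"
      using \<open>C \<ge> 0\<close> t.mass_lower[OF y] by (intro mult_left_mono) auto
    finally show ?thesis by (simp add: u.cyl_eq_mass t.cyl_eq_mass ac_simps)
  qed
  have "(\<lambda>n. C * L * (b / \<rho>) ^ n) \<longlonglongrightarrow> C * L * 0"
    using b \<rho> by (intro tendsto_intros LIMSEQ_realpow_zero) auto
  then have "eventually (\<lambda>n. C * L * (b / \<rho>) ^ n < 1) sequentially"
    by (rule order_tendstoD) simp
  then have ev: "eventually (\<lambda>n. C * L * b ^ n \<le> \<rho> ^ n) sequentially"
    by eventually_elim (use \<rho> in \<open>simp add: power_divide field_simps\<close>)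
  have "AE y in \<mu> \<theta>s. y \<in> Z"
    using s.Z_full s.Z_sets prob_eq_1 by blast
  with AE_a have "AE y in \<mu> \<theta>s. eventually (\<lambda>n. \<forall>\<theta>\<in>\<Theta>. dist \<theta> \<theta>\<^sub>1 < \<delta> \<longrightarrow>
        measure (\<mu> \<theta>) (cyl Z y n) \<le> \<rho> ^ n * measure (\<mu> \<theta>s) (cyl Z y n)) sequentially"
  proof eventually_elim
    case (elim y)
    from elim(1) ev show ?case
    proof eventually_elim
      case (elim n)
      show ?case
      proof (intro ballI impI)
        fix \<theta> assume \<theta>: "\<theta> \<in> \<Theta>" "dist \<theta> \<theta>\<^sub>1 < \<delta>"
        have "measure (\<mu> \<theta>) (cyl Z y n) \<le> C * L * exp (2 * \<eta>) ^ n * measure (\<mu> \<theta>\<^sub>1) (cyl Z y n)"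
          by (rule near[OF \<theta> \<open>y \<in> Z\<close>])
        also have "\<dots> \<le> C * L * exp (2 * \<eta>) ^ n * (a ^ n * measure (\<mu> \<theta>s) (cyl Z y n))"
          using elim(1) \<open>C \<ge> 0\<close> t.K_ge_1 by (intro mult_left_mono) auto
        also have "\<dots> = (C * L * b ^ n) * measure (\<mu> \<theta>s) (cyl Z y n)"
          by (simp add: b_def power_mult_distrib)
        also have "\<dots> \<le> \<rho> ^ n * measure (\<mu> \<theta>s) (cyl Z y n)"
          using elim(2) by (intro mult_right_mono) auto
        finally show "measure (\<mu> \<theta>) (cyl Z y n) \<le> \<rho> ^ n * measure (\<mu> \<theta>s) (cyl Z y n)" .
      qed
    qed
  qed
  with \<open>\<delta> > 0\<close> \<rho> show thesis by (intro that)
qed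

lemma compact_ratio_decay:
  assumes \<theta>s: "\<theta>s \<in> \<Theta>" and "compact S" "S \<subseteq> \<Theta>" and neq: "\<And>\<theta>. \<theta> \<in> S \<Longrightarrow> \<mu> \<theta> \<noteq> \<mu> \<theta>s"
  obtains \<rho> where "0 < \<rho>" "\<rho> < 1"
    "AE y in \<mu> \<theta>s. eventually (\<lambda>n. \<forall>\<theta>\<in>S.
        measure (\<mu> \<theta>) (cyl Z y n) \<le> \<rho> ^ n * measure (\<mu> \<theta>s) (cyl Z y n)) sequentially"
proof -
  define decay where "decay t \<delta> \<rho> \<longleftrightarrow> (AE y in \<mu> \<theta>s. eventually (\<lambda>n. \<forall>\<theta>\<in>\<Theta>. dist \<theta> t < \<delta> \<longrightarrow>
      measure (\<mu> \<theta>) (cyl Z y n) \<le> \<rho> ^ n * measure (\<mu> \<theta>s) (cyl Z y n)) sequentially)"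
    for t :: 'b and \<delta> \<rho> :: real
  have "\<forall>t\<in>S. \<exists>\<delta> \<rho>. \<delta> > 0 \<and> 0 < \<rho> \<and> \<rho> < 1 \<and> decay t \<delta> \<rho>"
  proof
    fix t assume "t \<in> S"
    then have "t \<in> \<Theta>" "\<mu> t \<noteq> \<mu> \<theta>s" using neq \<open>S \<subseteq> \<Theta>\<close> by auto
    from local_ratio_decay[OF \<theta>s this] show "\<exists>\<delta> \<rho>. \<delta> > 0 \<and> 0 < \<rho> \<and> \<rho> < 1 \<and> decay t \<delta> \<rho>"
      unfolding decay_def by blast
  qed
  then obtain d r where d: "\<And>t. t \<in> S \<Longrightarrow> d t > 0"
    and r: "\<And>t. t \<in> S \<Longrightarrow> 0 < r t" "\<And>t. t \<in> S \<Longrightarrow> r t < 1"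
    and dr: "\<And>t. t \<in> S \<Longrightarrow> decay t (d t) (r t)"
    by metis
  obtain T where T: "T \<subseteq> S" "finite T" "S \<subseteq> (\<Union>t\<in>T. ball t (d t))"
  proof (rule compactE_image[OF \<open>compact S\<close>, of S "\<lambda>t. ball t (d t)"])
    show "S \<subseteq> (\<Union>t\<in>S. ball t (d t))" using d by force
  qed auto
  \<comment> \<open>Inserting 1/2 makes the maximum exist and be positive even if \<open>T\<close>
    is empty.\<close>
  define \<rho> where "\<rho> = Max (insert (1/2) (r ` T))"
  have \<rho>_ge: "r t \<le> \<rho>" if "t \<in> T" for t
    unfolding \<rho>_def using T that by (intro Max_ge) auto
  have "1/2 \<le> \<rho>" unfolding \<rho>_def using T by (intro Max_ge) auto
  then have \<rho>: "0 < \<rho>" "\<rho> < 1"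
    using T r by (auto simp: \<rho>_def subset_iff)
  have "AE y in \<mu> \<theta>s. \<forall>t\<in>T. eventually (\<lambda>n. \<forall>\<theta>\<in>\<Theta>. dist \<theta> t < d t \<longrightarrow>
        measure (\<mu> \<theta>) (cyl Z y n) \<le> r t ^ n * measure (\<mu> \<theta>s) (cyl Z y n)) sequentially"
    using dr T(1) unfolding decay_def by (intro AE_finite_allI T(2)) blast
  then have "AE y in \<mu> \<theta>s. eventually (\<lambda>n. \<forall>\<theta>\<in>S.
        measure (\<mu> \<theta>) (cyl Z y n) \<le> \<rho> ^ n * measure (\<mu> \<theta>s) (cyl Z y n)) sequentially"
  proof eventually_elim
    case (elim y)
    then have "eventually (\<lambda>n. \<forall>t\<in>T. \<forall>\<theta>\<in>\<Theta>. dist \<theta> t < d t \<longrightarrow>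
        measure (\<mu> \<theta>) (cyl Z y n) \<le> r t ^ n * measure (\<mu> \<theta>s) (cyl Z y n)) sequentially"
      using T(2) by (simp add: eventually_ball_finite_distrib)
    then show ?case
    proof eventually_elim
      case (elim n)
      show ?case
      proof
        fix \<theta> assume "\<theta> \<in> S"
        then obtain t where t: "t \<in> T" "dist \<theta> t < d t"
          using T(3) by (auto simp: dist_commute)
        with elim \<open>\<theta> \<in> S\<close> \<open>S \<subseteq> \<Theta>\<close>
        have "measure (\<mu> \<theta>) (cyl Z y n) \<le> r t ^ n * measure (\<mu> \<theta>s) (cyl Z y n)" by blast
        also have "\<dots> \<le> \<rho> ^ n * measure (\<mu> \<theta>s) (cyl Z y n)"
          using \<rho>_ge[OF t(1)] r(1)[of t] t(1) T(1) by (intro mult_right_mono power_mono) auto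
        finally show "measure (\<mu> \<theta>) (cyl Z y n) \<le> \<rho> ^ n * measure (\<mu> \<theta>s) (cyl Z y n)" .
      qed
    qed
  qed
  with \<rho> show thesis by (rule that)
qed

end

subsection \<open>Lower bound on the evidence\<close>

text \<open>The Gibbs constants need not depend measurably on the parameter, so the bound is only
  pointwise in \<open>\<theta>\<close> and is integrated by Fatou's lemma. Where \<open>\<theta> \<mapsto> \<mu>\<^sub>\<theta>(C)\<close> fails to be
  measurable, the Bochner integral is \<open>0\<close> by convention, hence the hypothesis in the conclusion.\<close>

lemma (in gibbs_family) eventually_evidence_ge:
  assumes prior: "prob_space \<Pi>0" "space \<Pi>0 = \<Theta>" "sets \<Pi>0 = sets (restrict_space borel \<Theta>)"
    and full_support: "\<forall>V. openin (top_of_set \<Theta>) V \<and> V \<noteq> {} \<longrightarrow> emeasure \<Pi>0 V > 0"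
    and \<theta>s: "\<theta>s \<in> \<Theta>" and y: "y \<in> Z" and t: "0 < t" "t < 1"
  shows "eventually (\<lambda>n. (\<lambda>\<theta>. measure (\<mu> \<theta>) (cyl Z y n)) \<in> borel_measurable \<Pi>0 \<longrightarrow>
    t ^ n * measure (\<mu> \<theta>s) (cyl Z y n) \<le> (\<integral>\<theta>. measure (\<mu> \<theta>) (cyl Z y n) \<partial>\<Pi>0)) sequentially"
proof -
  interpret prob_space \<Pi>0 by fact
  obtain K P where s: "gibbs_state Z N (\<mu> \<theta>s) (f \<theta>s) K P" using ex_state[OF \<theta>s] .
  interpret s: gibbs_state Z N "\<mu> \<theta>s" "f \<theta>s" K P by (rule s)
  define p where "p n = measure (\<mu> \<theta>s) (cyl Z y n)" for n
  have p: "p n > 0" for n using s.mass_pos[OF y] by (simp add: p_def s.cyl_eq_mass)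
  define m where "m n \<theta> = measure (\<mu> \<theta>) (cyl Z y n)" for n \<theta>
  \<comment> \<open>Moving to a neighbour costs two thirds of the rate of \<open>t\<close>; the last
    third survives as \<open>exp (- \<eta>)\<close>.\<close>
  define \<eta> where "\<eta> = - ln t / 3"
  have \<eta>: "\<eta> > 0" using t by (simp add: \<eta>_def)
  have t_eq: "exp (2 * \<eta>) * t = exp (- \<eta>)"
  proof -
    have "exp (2 * \<eta>) * t = exp (2 * \<eta> + ln t)" using t by (simp add: exp_add)
    also have "2 * \<eta> + ln t = - \<eta>" by (simp add: \<eta>_def)
    finally show ?thesis .
  qed
  obtain \<delta> where "\<delta> > 0" and \<delta>: "\<And>\<theta> x. \<theta> \<in> \<Theta> \<Longrightarrow> dist \<theta> \<theta>s < \<delta> \<Longrightarrow> x \<in> Z \<Longrightarrow> \<bar>f \<theta> x - f \<theta>s x\<bar> \<le> \<eta>"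
  proof (rule local_bounds[OF \<theta>s])
    fix M D
    assume "\<And>\<eta>. \<eta> > 0 \<Longrightarrow> \<exists>\<delta>>0. \<forall>\<theta>\<in>\<Theta>. dist \<theta> \<theta>s < \<delta> \<longrightarrow>
      (\<forall>x\<in>Z. \<bar>f \<theta> x - f \<theta>s x\<bar> \<le> \<eta>) \<and> (\<forall>x\<in>Z. \<bar>f \<theta> x\<bar> \<le> M) \<and>
      (\<forall>x\<in>Z. \<forall>y\<in>Z. \<forall>n. window x n = window y n \<longrightarrow> \<bar>birkhoff (f \<theta>) x n - birkhoff (f \<theta>) y n\<bar> \<le> D)"
    from this[OF \<eta>] show thesis using that by blast
  qed
  define V where "V = \<Theta> \<inter> ball \<theta>s \<delta>"
  have V_sets: "V \<in> sets \<Pi>0"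
    unfolding V_def prior(3) sets_restrict_space by (intro imageI) simp
  have "openin (top_of_set \<Theta>) V" unfolding V_def by (rule openin_open_Int) simp
  moreover have "V \<noteq> {}" using \<theta>s \<open>\<delta> > 0\<close> by (auto simp: V_def)
  ultimately have "emeasure \<Pi>0 V > 0" using full_support by blast
  define c where "c = prob V"
  have c: "c > 0" using \<open>emeasure \<Pi>0 V > 0\<close> by (simp add: c_def emeasure_eq_measure)
  define meas where "meas n \<longleftrightarrow> m n \<in> borel_measurable \<Pi>0" for n
  \<comment> \<open>Lengths at which the likelihood is not measurable get the value
    \<open>top\<close>. This keeps \<open>u n\<close> measurable for Fatou and cannot lower the
    limit inferior.\<close>
  define u where "u n \<theta> = (if meas n then ennreal (m n \<theta> / (t ^ n * p n)) else top)" for n \<theta>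
  have u_meas: "u n \<in> borel_measurable \<Pi>0" for n
  proof (cases "meas n")
    case True
    then have [measurable]: "m n \<in> borel_measurable \<Pi>0" by (simp add: meas_def)
    have "(\<lambda>\<theta>. ennreal (m n \<theta> / (t ^ n * p n))) \<in> borel_measurable \<Pi>0" by measurable
    with True show ?thesis by (simp add: u_def[abs_def])
  qed (simp add: u_def[abs_def])
  \<comment> \<open>For fixed \<open>\<theta>\<close> in \<open>V\<close> the ratio outgrows every
    bound, although the constant \<open>L\<close> depends on \<open>\<theta>\<close>. The threshold
    \<open>2 / c\<close> gives the integral over \<open>V\<close> the value 2, strictly above the
    required 1.\<close>
  have lim: "ennreal (2 / c) * indicator V \<theta> \<le> liminf (\<lambda>n. u n \<theta>)" for \<theta>
  proof (cases "\<theta> \<in> V")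
    case True
    then have \<theta>: "\<theta> \<in> \<Theta>" "dist \<theta> \<theta>s < \<delta>" by (auto simp: V_def dist_commute)
    obtain L Q where q: "gibbs_state Z N (\<mu> \<theta>) (f \<theta>) L Q" using ex_state[OF \<theta>(1)] .
    interpret q: gibbs_state Z N "\<mu> \<theta>" "f \<theta>" L Q by (rule q)
    have m_ge: "p n \<le> K * L * exp (2 * \<eta>) ^ n * m n \<theta>" for n
    proof -
      have "p n \<le> K * weight (f \<theta>s) P y n"
        using s.mass_upper[OF y] by (simp add: p_def s.cyl_eq_mass)
      also have "\<dots> \<le> K * (exp (2 * \<eta>) ^ n * weight (f \<theta>) Q y n)"
        using s.K_ge_1 \<delta>[OF \<theta>] y
        by (intro mult_left_mono weight_comparison[OF s q]) (auto simp: abs_minus_commute)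
      also have "\<dots> \<le> K * (exp (2 * \<eta>) ^ n * (L * m n \<theta>))"
        using s.K_ge_1 q.mass_lower[OF y] by (intro mult_left_mono) (auto simp: m_def q.cyl_eq_mass)
      finally show ?thesis by (simp add: ac_simps)
    qed
    have KL: "K > 0" "L > 0" using s.K_ge_1 q.K_ge_1 by auto
    have "(\<lambda>n. exp (- \<eta>) ^ n) \<longlonglongrightarrow> 0"
      using \<eta> by (intro LIMSEQ_realpow_zero) auto
    then have "eventually (\<lambda>n. exp (- \<eta>) ^ n < c / (2 * K * L)) sequentially"
      using c KL by (intro order_tendstoD) auto
    then have "eventually (\<lambda>n. ennreal (2 / c) \<le> u n \<theta>) sequentially"
    proof eventually_elim
      case (elim n)
      have "t ^ n * p n \<le> t ^ n * (K * L * exp (2 * \<eta>) ^ n * m n \<theta>)"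
        using t by (intro mult_left_mono m_ge) auto
      also have "\<dots> = K * L * exp (- \<eta>) ^ n * m n \<theta>"
        by (simp add: power_mult_distrib flip: t_eq)
      also have "\<dots> \<le> K * L * (c / (2 * K * L)) * m n \<theta>"
        using elim KL by (intro mult_right_mono mult_left_mono) (auto simp: m_def)
      also have "\<dots> = c / 2 * m n \<theta>" using KL by simp
      finally have "2 / c \<le> m n \<theta> / (t ^ n * p n)"
        using c t p[of n] by (simp add: field_simps)
      then show ?case by (auto simp: u_def intro!: ennreal_leI)
    qed
    with True show ?thesis by (simp add: Liminf_bounded)
  qed simp
  have "2 = ennreal (2 / c) * emeasure \<Pi>0 V"
    using c by (simp add: emeasure_eq_measure c_def[symmetric] flip: ennreal_mult')
  also have "\<dots> = (\<integral>\<^sup>+\<theta>. ennreal (2 / c) * indicator V \<theta> \<partial>\<Pi>0)"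
    using V_sets by (simp add: nn_integral_cmult_indicator)
  also have "\<dots> \<le> (\<integral>\<^sup>+\<theta>. liminf (\<lambda>n. u n \<theta>) \<partial>\<Pi>0)"
    by (intro nn_integral_mono lim)
  also have "\<dots> \<le> liminf (\<lambda>n. integral\<^sup>N \<Pi>0 (u n))"
    by (rule nn_integral_liminf[OF u_meas])
  finally have "(1 :: ennreal) < liminf (\<lambda>n. integral\<^sup>N \<Pi>0 (u n))"
    by (rule less_le_trans[rotated]) simp
  then have "eventually (\<lambda>n. 1 < integral\<^sup>N \<Pi>0 (u n)) sequentially"
    by (rule less_LiminfD)
  then show ?thesis
  proof eventually_elim
    case (elim n)
    show ?case
    proof
      assume "(\<lambda>\<theta>. measure (\<mu> \<theta>) (cyl Z y n)) \<in> borel_measurable \<Pi>0"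
      then have mn: "m n \<in> borel_measurable \<Pi>0" by (simp add: m_def[abs_def])
      have "m n \<theta> \<le> 1" if "\<theta> \<in> \<Theta>" for \<theta>
      proof -
        have "prob_space (\<mu> \<theta>)" using gibbs[OF that] by (simp add: gibbs_measure_def)
        then show ?thesis by (simp add: m_def prob_space.prob_le_1)
      qed
      then have int: "integrable \<Pi>0 (m n)"
        using mn prior(2) by (intro integrable_const_bound[of _ 1]) (auto simp: m_def)
      have "integral\<^sup>N \<Pi>0 (u n) = (\<integral>\<^sup>+\<theta>. ennreal (m n \<theta> / (t ^ n * p n)) \<partial>\<Pi>0)"
        using mn by (intro nn_integral_cong) (simp add: u_def meas_def)
      also have "\<dots> = ennreal (\<integral>\<theta>. m n \<theta> / (t ^ n * p n) \<partial>\<Pi>0)"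
      proof (rule nn_integral_eq_integral)
        show "integrable \<Pi>0 (\<lambda>\<theta>. m n \<theta> / (t ^ n * p n))" using int by simp
        show "AE \<theta> in \<Pi>0. 0 \<le> m n \<theta> / (t ^ n * p n)"
          using t p[of n] by (intro AE_I2) (simp add: m_def)
      qed
      finally have "1 < (\<integral>\<theta>. m n \<theta> / (t ^ n * p n) \<partial>\<Pi>0)"
        using elim by (simp add: ennreal_less_iff[of 1, simplified])
      also have "\<dots> = (\<integral>\<theta>. m n \<theta> \<partial>\<Pi>0) / (t ^ n * p n)" by simp
      finally show "t ^ n * measure (\<mu> \<theta>s) (cyl Z y n) \<le> (\<integral>\<theta>. measure (\<mu> \<theta>) (cyl Z y n) \<partial>\<Pi>0)"
        using t p[of n] by (simp add: field_simps m_def p_def)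
    qed
  qed
qed

text \<open>All mass sits on a single point, so both measures are the Dirac measure there. This
  settles the shifts excluded by \<open>two_points\<close>.\<close>

lemma gibbs_measure_singleton_unique:
  assumes sub: "\<And>a b. a \<in> Z \<Longrightarrow> b \<in> Z \<Longrightarrow> a = b"
    and "gibbs_measure Z f \<mu>" "gibbs_measure Z g \<nu>"
  shows "\<mu> = \<nu>"
proof -
  have *: "emeasure \<kappa> A = (if Z \<subseteq> A then 1 else 0)"
    if \<kappa>: "gibbs_measure Z h \<kappa>" and A: "A \<in> sets \<kappa>" for h \<kappa> A
  proof -
    have Z: "Z \<in> sets \<kappa>" "emeasure \<kappa> Z = 1" and "prob_space \<kappa>"
      using \<kappa> by (auto simp: gibbs_measure_def)
    interpret prob_space \<kappa> by fact
    have "AE z in \<kappa>. z \<in> Z"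
      using Z prob_eq_1[OF Z(1)] by (simp add: measure_def)
    then have "emeasure \<kappa> A = emeasure \<kappa> (A \<inter> Z)"
      using A Z by (intro emeasure_eq_AE) auto
    moreover have "A \<inter> Z = (if Z \<subseteq> A then Z else {})"
      using sub by auto
    ultimately show ?thesis using Z by simp
  qed
  show ?thesis
    using assms by (intro measure_eqI) (simp_all add: *[OF assms(2)] *[OF assms(3)] gibbs_measure_def)
qed

subsection \<open>Posterior consistency\<close>

theorem theorem2p1:
  fixes Z :: "(int \<Rightarrow> 'a::finite) set"
    and \<Theta> :: "'b::metric_space set"
    and f :: "'b \<Rightarrow> (int \<Rightarrow> 'a) \<Rightarrow> real"
    and \<mu> :: "'b \<Rightarrow> (int \<Rightarrow> 'a) measure"
    and \<Pi>0 :: "'b measure"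
    and \<theta>s :: 'b
    and U :: "'b set"
  assumes Z: "mixing_sft Z"
    and \<Theta>: "compact \<Theta>"
    and reg: "regular_family Z \<Theta> f"
    and gibbs: "\<forall>\<theta>\<in>\<Theta>. gibbs_measure Z (f \<theta>) (\<mu> \<theta>)"
    and prior: "prob_space \<Pi>0" "space \<Pi>0 = \<Theta>" "sets \<Pi>0 = sets (restrict_space borel \<Theta>)"
    and full_support: "\<forall>V. openin (top_of_set \<Theta>) V \<and> V \<noteq> {} \<longrightarrow> emeasure \<Pi>0 V > 0"
    and \<theta>s: "\<theta>s \<in> \<Theta>"
    and U: "openin (top_of_set \<Theta>) U" "{\<theta>\<in>\<Theta>. \<mu> \<theta> = \<mu> \<theta>s} \<subseteq> U"
  shows "AE y in \<mu> \<theta>s. (\<lambda>n. posterior Z \<Pi>0 \<mu> n y (\<Theta> - U)) \<longlonglongrightarrow> 0"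
proof (cases "\<exists>a\<in>Z. \<exists>b\<in>Z. a \<noteq> b")
  case False
  then have "\<mu> \<theta> = \<mu> \<theta>s" if "\<theta> \<in> \<Theta>" for \<theta>
    using gibbs \<theta>s that by (intro gibbs_measure_singleton_unique[of Z]) auto
  with U(2) have "\<Theta> - U = {}" by blast
  then show ?thesis unfolding \<open>\<Theta> - U = {}\<close> by (simp add: posterior_def)
next
  case True
  obtain N where "glued_shift Z N" using mixing_sft_glued_shift[OF Z] .
  then interpret gibbs_family Z N \<Theta> f \<mu>
    using reg gibbs True by (intro gibbs_family.intro gibbs_family_axioms.intro) blast+
  interpret \<Pi>: prob_space \<Pi>0 by fact
  obtain K P where "gibbs_state Z N (\<mu> \<theta>s) (f \<theta>s) K P" using ex_state[OF \<theta>s] .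
  then interpret s: gibbs_state Z N "\<mu> \<theta>s" "f \<theta>s" K P .
  obtain W where W: "open W" "U = \<Theta> \<inter> W" using U(1) by (auto simp: openin_open)
  have diff: "\<Theta> - U = \<Theta> \<inter> - W" using W by auto
  have "compact (\<Theta> - U)" unfolding diff using \<Theta> W by (intro compact_Int_closed) auto
  then obtain \<rho> where \<rho>: "0 < \<rho>" "\<rho> < 1" and decay: "AE y in \<mu> \<theta>s. eventually (\<lambda>n. \<forall>\<theta>\<in>\<Theta> - U.
      measure (\<mu> \<theta>) (cyl Z y n) \<le> \<rho> ^ n * measure (\<mu> \<theta>s) (cyl Z y n)) sequentially"
  proof (rule compact_ratio_decay[OF \<theta>s])
    show "\<mu> \<theta> \<noteq> \<mu> \<theta>s" if "\<theta> \<in> \<Theta> - U" for \<theta> using U(2) that by blast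
  qed auto
  \<comment> \<open>Relative to the true likelihood the numerator decays like
    \<open>\<rho> ^ n\<close>; granting the evidence a loss of \<open>t ^ n\<close> leaves
    \<open>t ^ n\<close> for the posterior.\<close>
  define t where "t = sqrt \<rho>"
  have t: "0 < t" "t < 1" and t_sq: "t * t = \<rho>" using \<rho> by (auto simp: t_def)
  have "AE y in \<mu> \<theta>s. y \<in> Z"
    using s.Z_full s.Z_sets prob_space.prob_eq_1[OF s.prob] by blast
  with decay show ?thesis
  proof eventually_elim
    case (elim y)
    note y = \<open>y \<in> Z\<close>
    let ?m = "\<lambda>n \<theta>. measure (\<mu> \<theta>) (cyl Z y n)"
    have pos: "?m n \<theta>s > 0" for n using s.mass_pos[OF y] by (simp add: s.cyl_eq_mass)
    have nonneg: "posterior Z \<Pi>0 \<mu> n y (\<Theta> - U) \<ge> 0" for n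
      unfolding posterior_def by (intro divide_nonneg_nonneg Bochner_Integration.integral_nonneg) auto
    from elim(1) eventually_evidence_ge[OF prior full_support \<theta>s y t]
    have "eventually (\<lambda>n. posterior Z \<Pi>0 \<mu> n y (\<Theta> - U) \<le> t ^ n) sequentially"
    proof eventually_elim
      case (elim n)
      show ?case
      proof (cases "?m n \<in> borel_measurable \<Pi>0")
        case False
        \<comment> \<open>The evidence is 0 by the convention for non-integrable functions, and
          division by 0 then makes the posterior 0.\<close>
        then have "(\<integral>\<theta>. ?m n \<theta> \<partial>\<Pi>0) = 0"
          by (intro not_integrable_integral_eq) (blast dest: borel_measurable_integrable)
        then show ?thesis using t by (simp add: posterior_def)
      next
        case True
        have "\<Theta> - U \<in> sets \<Pi>0"
          unfolding diff prior(3) sets_restrict_space using W(1) by (intro imageI) simp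
        then have [measurable]: "\<Theta> - U \<in> sets \<Pi>0" "?m n \<in> borel_measurable \<Pi>0" using True by -
        have le: "indicator (\<Theta> - U) \<theta> * ?m n \<theta> \<le> \<rho> ^ n * ?m n \<theta>s" for \<theta>
        proof (cases "\<theta> \<in> \<Theta> - U")
          case True
          with elim(1) show ?thesis by simp
        next
          case False
          then have "indicator (\<Theta> - U) \<theta> = (0 :: real)" by (rule indicator_simps(2))
          then show ?thesis using \<rho> by simp
        qed
        have "(\<integral>\<theta>. indicator (\<Theta> - U) \<theta> * ?m n \<theta> \<partial>\<Pi>0) \<le> (\<integral>\<theta>. \<rho> ^ n * ?m n \<theta>s \<partial>\<Pi>0)"
        proof (intro integral_mono le)
          show "integrable \<Pi>0 (\<lambda>\<theta>. indicator (\<Theta> - U) \<theta> * ?m n \<theta>)"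
          proof (rule \<Pi>.integrable_const_bound)
            show "AE \<theta> in \<Pi>0. norm (indicator (\<Theta> - U) \<theta> * ?m n \<theta>) \<le> \<rho> ^ n * ?m n \<theta>s"
              using le by (intro AE_I2) simp
          qed measurable
        qed simp
        then have num: "(\<integral>\<theta>. indicator (\<Theta> - U) \<theta> * ?m n \<theta> \<partial>\<Pi>0) \<le> \<rho> ^ n * ?m n \<theta>s"
          by (simp add: \<Pi>.prob_space)
        have den: "t ^ n * ?m n \<theta>s \<le> (\<integral>\<theta>. ?m n \<theta> \<partial>\<Pi>0)" using elim(2) True by blast
        have den_pos: "t ^ n * ?m n \<theta>s > 0" using t pos by simp
        have "posterior Z \<Pi>0 \<mu> n y (\<Theta> - U) \<le> (\<rho> ^ n * ?m n \<theta>s) / (t ^ n * ?m n \<theta>s)"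
          unfolding posterior_def using \<rho> by (intro frac_le num den den_pos) simp
        also have "\<dots> = t ^ n"
        proof -
          have "\<rho> ^ n = t ^ n * t ^ n" by (simp add: power_mult_distrib flip: t_sq)
          then show ?thesis using t pos[of n] by simp
        qed
        finally show ?thesis .
      qed
    qed
    moreover have "(\<lambda>n. t ^ n) \<longlonglongrightarrow> 0" using t by (intro LIMSEQ_realpow_zero) auto
    ultimately show ?case
      by (rule tendsto_sandwich[OF always_eventually[OF allI[OF nonneg]] _ tendsto_const])
  qed
qed

end
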